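(* Let $X$ be a space such that $H_q(X)$ is finitely generated for every $q$, and assume that $N_*\mathcal{E}(X)$ and $N^*\mathcal{E}(X)$ are defined (with values in $\{0,1,2,\dots,\infty\}$). Then $N^*\mathcal{E}(X)\leq N_*\mathcal{E}(X)+1$.
   Context: Spaces, maps and homotopies are based; $[X,X]$ is the set of based homotopy classes of self-maps of $X$, and $\mathcal{E}(X)\subset [X,X]$ is the set of homotopy classes of self-homotopy equivalences. Let $\mathcal{A}_*^k(X)$ and $\mathcal{A}^*_k(X)$ be the sets of $f\in[X,X]$ inducing isomorphisms for all $i\le k$ on integral homology $H_i(X)$ and on integral cohomology $H^i(X)$, respectively. Then $N_*\mathcal{E}(X)=\min\{k:\mathcal{A}_*^k(X)=\mathcal{E}(X)\}$ and $N^*\mathcal{E}(X)=\min\{k:\mathcal{A}^*_k(X)=\mathcal{E}(X)\}$, where $k$ ranges over $0,1,2,\dots,\infty$; each number is undefined if no such $k$ exists. *)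

theory Defs
  imports "HOL-Homology.Homology" "HOL-Library.Extended_Nat"
begin

section \<open>Singular cohomology with integer coefficients\<close>

text \<open>
  \<open>C\<^sup>p(X) = Hom(C\<^sub>p(X), \<int>)\<close>, where \<open>C\<^sub>p(X)\<close> is \<^const>\<open>chain_group\<close>. Cochains are extensional, so
  that equality of cochains is equality of functions in HOL.
\<close>

definition cochain_group :: "nat \<Rightarrow> 'a topology \<Rightarrow> ('a chain \<Rightarrow> int) monoid" where
  "cochain_group p X =
     \<lparr>carrier = hom (chain_group p X) integer_group \<inter> extensional (carrier (chain_group p X)),
      monoid.mult = (\<lambda>\<phi> \<psi>. \<lambda>c\<in>carrier (chain_group p X). \<phi> c + \<psi> c),
      one = (\<lambda>c\<in>carrier (chain_group p X). 0)\<rparr>"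

definition coboundary :: "nat \<Rightarrow> 'a topology \<Rightarrow> ('a chain \<Rightarrow> int) \<Rightarrow> ('a chain \<Rightarrow> int)" where
  "coboundary p X \<phi> = (\<lambda>c\<in>carrier (chain_group (Suc p) X). \<phi> (chain_boundary (Suc p) c))"

definition cocycle_set :: "nat \<Rightarrow> 'a topology \<Rightarrow> ('a chain \<Rightarrow> int) set" where
  "cocycle_set p X = kernel (cochain_group p X) (cochain_group (Suc p) X) (coboundary p X)"

definition coboundary_set :: "nat \<Rightarrow> 'a topology \<Rightarrow> ('a chain \<Rightarrow> int) set" where
  "coboundary_set p X =
     (case p of
        0 \<Rightarrow> {\<one>\<^bsub>cochain_group 0 X\<^esub>}
      | Suc q \<Rightarrow> coboundary q X ` carrier (cochain_group q X))"

definition cocycle_group :: "nat \<Rightarrow> 'a topology \<Rightarrow> ('a chain \<Rightarrow> int) monoid" where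
  "cocycle_group p X = subgroup_generated (cochain_group p X) (cocycle_set p X)"

definition cohomology_group :: "nat \<Rightarrow> 'a topology \<Rightarrow> ('a chain \<Rightarrow> int) set monoid" where
  "cohomology_group p X = cocycle_group p X Mod coboundary_set p X"

definition cochain_map ::
    "nat \<Rightarrow> 'a topology \<Rightarrow> ('a \<Rightarrow> 'b) \<Rightarrow> ('b chain \<Rightarrow> int) \<Rightarrow> ('a chain \<Rightarrow> int)" where
  "cochain_map p X f \<phi> = (\<lambda>c\<in>carrier (chain_group p X). \<phi> (chain_map p f c))"

text \<open>
  The map \<open>f\<^sup>* : H\<^sup>p(Y) \<rightarrow> H\<^sup>p(X)\<close> induced by a continuous \<open>f : X \<rightarrow> Y\<close>. A cohomology class of \<open>Y\<close>
  is a coset \<open>u\<close> of the coboundaries; the pullbacks of its members all lie in a single coset of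
  the coboundaries of \<open>X\<close>, and multiplying by the coboundaries recovers this coset from them.
\<close>

definition cohom_induced ::
    "nat \<Rightarrow> 'a topology \<Rightarrow> ('a \<Rightarrow> 'b) \<Rightarrow> ('b chain \<Rightarrow> int) set \<Rightarrow> ('a chain \<Rightarrow> int) set" where
  "cohom_induced p X f u = coboundary_set p X <#>\<^bsub>cocycle_group p X\<^esub> (cochain_map p X f ` u)"


section \<open>Based homotopy classes of self-maps\<close>

definition based_map :: "'a topology \<Rightarrow> 'a \<Rightarrow> ('a \<Rightarrow> 'a) \<Rightarrow> bool" where
  "based_map X x0 f \<longleftrightarrow> continuous_map X X f \<and> f x0 = x0"

definition based_homotopic :: "'a topology \<Rightarrow> 'a \<Rightarrow> ('a \<Rightarrow> 'a) \<Rightarrow> ('a \<Rightarrow> 'a) \<Rightarrow> bool" where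
  "based_homotopic X x0 = homotopic_with (\<lambda>h. h x0 = x0) X X"

definition self_map_classes :: "'a topology \<Rightarrow> 'a \<Rightarrow> ('a \<Rightarrow> 'a) set set" where
  "self_map_classes X x0 = {f. based_map X x0 f} // {(f, g). based_homotopic X x0 f g}"

definition based_homotopy_equivalence :: "'a topology \<Rightarrow> 'a \<Rightarrow> ('a \<Rightarrow> 'a) \<Rightarrow> bool" where
  "based_homotopy_equivalence X x0 f \<longleftrightarrow>
     based_map X x0 f \<and>
     (\<exists>g. based_map X x0 g \<and> based_homotopic X x0 (g \<circ> f) id \<and> based_homotopic X x0 (f \<circ> g) id)"

text \<open>
  The defining properties below are invariant under based homotopy, so asking for one
  representative of a class is the same as asking for all of them.
\<close>

definition self_equivalence_classes :: "'a topology \<Rightarrow> 'a \<Rightarrow> ('a \<Rightarrow> 'a) set set" where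
  "self_equivalence_classes X x0 =
     {C \<in> self_map_classes X x0. \<exists>f\<in>C. based_homotopy_equivalence X x0 f}"

definition homology_iso_classes :: "enat \<Rightarrow> 'a topology \<Rightarrow> 'a \<Rightarrow> ('a \<Rightarrow> 'a) set set" where
  "homology_iso_classes k X x0 =
     {C \<in> self_map_classes X x0. \<exists>f\<in>C. \<forall>i::nat. enat i \<le> k \<longrightarrow>
        hom_induced (int i) X {} X {} f \<in> iso (homology_group (int i) X) (homology_group (int i) X)}"

definition cohomology_iso_classes :: "enat \<Rightarrow> 'a topology \<Rightarrow> 'a \<Rightarrow> ('a \<Rightarrow> 'a) set set" where
  "cohomology_iso_classes k X x0 =
     {C \<in> self_map_classes X x0. \<exists>f\<in>C. \<forall>i::nat. enat i \<le> k \<longrightarrow>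
        cohom_induced i X f \<in> iso (cohomology_group i X) (cohomology_group i X)}"


section \<open>Self-closeness numbers\<close>

definition homology_self_closeness_defined :: "'a topology \<Rightarrow> 'a \<Rightarrow> bool" where
  "homology_self_closeness_defined X x0 \<longleftrightarrow>
     (\<exists>k. homology_iso_classes k X x0 = self_equivalence_classes X x0)"

definition cohomology_self_closeness_defined :: "'a topology \<Rightarrow> 'a \<Rightarrow> bool" where
  "cohomology_self_closeness_defined X x0 \<longleftrightarrow>
     (\<exists>k. cohomology_iso_classes k X x0 = self_equivalence_classes X x0)"

text \<open>The two numbers below are meaningful only when the respective predicate above holds.\<close>

definition homology_self_closeness :: "'a topology \<Rightarrow> 'a \<Rightarrow> enat" where
  "homology_self_closeness X x0 =
     (LEAST k. homology_iso_classes k X x0 = self_equivalence_classes X x0)"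

definition cohomology_self_closeness :: "'a topology \<Rightarrow> 'a \<Rightarrow> enat" where
  "cohomology_self_closeness X x0 =
     (LEAST k. cohomology_iso_classes k X x0 = self_equivalence_classes X x0)"

definition finitely_generated_group :: "('a, 'b) monoid_scheme \<Rightarrow> bool" where
  "finitely_generated_group G \<longleftrightarrow>
     (\<exists>S. finite S \<and> S \<subseteq> carrier G \<and> generate G S = carrier G)"

end

theory Submission
  imports Defs
begin

text \<open>
  Write \<open>n\<close> for the homological number. If the cohomological number exceeds \<open>n + 1\<close>, then every class
  of self-equivalences lies in the set of classes inducing isomorphisms on \<open>H\<^sup>i\<close> for \<open>i \<le> n + 1\<close>, so it
  suffices that a map inducing isomorphisms on \<open>H\<^sup>p\<close> and \<open>H\<^sup>p\<^sup>+\<^sup>1\<close> induces one on \<open>H\<^sub>p\<close>. Since \<open>\<rat>/\<int>\<close> is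
  an injective cogenerator, \<open>f\<^sub>*\<close> is bijective on \<open>H\<^sub>p\<close> if it is so on \<open>Hom(H\<^sub>p, \<rat>/\<int>) = H\<^sup>p(X; \<rat>/\<int>)\<close>,
  and this follows by the five lemma from the coefficient sequence of \<open>\<int> \<rightarrow> \<rat> \<rightarrow> \<rat>/\<int>\<close>, once \<open>f\<^sup>*\<close> is
  bijective on \<open>Hom(H\<^sub>i, \<rat>)\<close> for \<open>i = p, p + 1\<close>. As \<open>H\<^sub>i\<close> is finitely generated, every element of this
  space has an integral multiple, so \<open>f\<^sup>*\<close> is surjective on it, hence injective by finiteness of the
  dimension. Homomorphisms to \<open>\<rat>/\<int>\<close> are represented by rational-valued ones, taken modulo \<open>\<int>\<close>.
\<close>

section \<open>Extension of homomorphisms to \<open>\<rat>\<close> and \<open>\<rat>/\<int>\<close>\<close>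

definition add_subgroup :: "'a::ab_group_add set \<Rightarrow> bool" where
  "add_subgroup A \<longleftrightarrow> 0 \<in> A \<and> (\<forall>x\<in>A. \<forall>y\<in>A. x - y \<in> A)"

text \<open>Additivity is asked only on \<open>A\<close>, because cochains are controlled only on
  the chains of the space.\<close>

definition additive_on :: "'a::ab_group_add set \<Rightarrow> ('a \<Rightarrow> 'b::ab_group_add) \<Rightarrow> bool" where
  "additive_on A h \<longleftrightarrow> (\<forall>x\<in>A. \<forall>y\<in>A. h (x + y) = h x + h y)"

lemma add_subgroup_0: "add_subgroup A \<Longrightarrow> 0 \<in> A"
  by (simp add: add_subgroup_def)

lemma add_subgroup_diff: "add_subgroup A \<Longrightarrow> x \<in> A \<Longrightarrow> y \<in> A \<Longrightarrow> x - y \<in> A"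
  by (simp add: add_subgroup_def)

lemma add_subgroup_minus: "add_subgroup A \<Longrightarrow> x \<in> A \<Longrightarrow> - x \<in> A"
  by (metis add_subgroup_def diff_0)

lemma add_subgroup_add: "add_subgroup A \<Longrightarrow> x \<in> A \<Longrightarrow> y \<in> A \<Longrightarrow> x + y \<in> A"
  by (metis add_subgroup_diff add_subgroup_minus diff_minus_eq_add)

lemma additive_on_0:
  assumes "add_subgroup A" "additive_on A h" shows "h 0 = 0"
  using assms unfolding add_subgroup_def additive_on_def by (metis add_cancel_left_left)

lemma additive_on_diff:
  assumes "add_subgroup A" "additive_on A h" "x \<in> A" "y \<in> A"
  shows "h (x - y) = h x - h y"
proof -
  have "h (x - y + y) = h (x - y) + h y"
    using assms add_subgroup_diff[OF assms(1,3,4)] unfolding additive_on_def by blast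
  then show ?thesis by (simp add: algebra_simps)
qed

lemma additive_on_subset: "additive_on B h \<Longrightarrow> A \<subseteq> B \<Longrightarrow> additive_on A h"
  by (auto simp: additive_on_def)

lemma add_subgroup_image:
  assumes "add_subgroup A" "additive_on A h" shows "add_subgroup (h ` A)"
  unfolding add_subgroup_def
proof (intro conjI ballI)
  show "0 \<in> h ` A"
    using additive_on_0[OF assms] add_subgroup_0[OF assms(1)] by force
  fix u v assume "u \<in> h ` A" "v \<in> h ` A"
  then obtain x y where "x \<in> A" "y \<in> A" "u = h x" "v = h y" by blast
  then show "u - v \<in> h ` A"
    using additive_on_diff[OF assms, of x y] add_subgroup_diff[OF assms(1), of x y] by (metis imageI)
qed

lemma add_subgroup_vimage:
  assumes "add_subgroup A" "additive_on A h" "add_subgroup J"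
  shows "add_subgroup {x\<in>A. h x \<in> J}"
  unfolding add_subgroup_def
proof (intro conjI ballI)
  show "0 \<in> {x\<in>A. h x \<in> J}"
    using add_subgroup_0[OF assms(1)] add_subgroup_0[OF assms(3)] additive_on_0[OF assms(1,2)] by simp
  show "x - y \<in> {x\<in>A. h x \<in> J}" if "x \<in> {x\<in>A. h x \<in> J}" "y \<in> {x\<in>A. h x \<in> J}" for x y
    using that add_subgroup_diff[OF assms(1), of x y] add_subgroup_diff[OF assms(3), of "h x" "h y"]
      additive_on_diff[OF assms(1,2), of x y] by simp
qed

lemma add_subgroup_Ints: "add_subgroup (\<int> :: 'a::ring_1 set)"
  by (simp add: add_subgroup_def)

lemma add_subgroup_zero: "add_subgroup {0}"
  by (simp add: add_subgroup_def)

text \<open>The instances take \<open>h k\<close> to be the \<open>k\<close>-fold multiple of a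
  fixed element, which is an integer in one case and a pair of a chain and a rational in the
  other.\<close>

lemma int_multiple_in_add_subgroup:
  fixes h :: "int \<Rightarrow> 'a::ab_group_add"
  assumes A: "add_subgroup A" and h: "additive_on UNIV h" and 1: "h 1 \<in> A"
  shows "h k \<in> A"
proof (induction k rule: int_induct[where k = 0])
  case base
  then show ?case
    using additive_on_0[OF _ h] A by (simp add: add_subgroup_def)
next
  case (step1 i)
  then show ?case
    using h add_subgroup_add[OF A _ 1] by (simp add: additive_on_def)
next
  case (step2 i)
  have "h (i - 1) = h i - h 1"
    using additive_on_diff[OF _ h] by (simp add: add_subgroup_def)
  then show ?case
    using step2 add_subgroup_diff[OF A _ 1] by simp
qed

lemma multiple_pair_in_add_subgroup:
  fixes y :: rat
  assumes "add_subgroup A" "(x, y) \<in> A" shows "(frag_cmul k x, of_int k * y) \<in> A"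
  by (rule int_multiple_in_add_subgroup[OF assms(1), of "\<lambda>k. (frag_cmul k x, of_int k * y)"])
    (use assms in \<open>auto simp: additive_on_def frag_cmul_distrib algebra_simps\<close>)

section \<open>Injectivity and separation properties of \<rat> and \<rat>/\<int>\<close>

text \<open>\<open>K\<close> consists of the multiples of some \<open>n\<close>. The value 1/n works
  if \<open>n\<close> is positive, and 1/2 works for the zero subgroup. Thus \<open>r\<close> is the
  value at 1 of a character of \<int> modulo \<open>K\<close> in \<rat>/\<int>, nontrivial unless
  \<open>K\<close> contains 1.\<close>

lemma ex_rat_annihilating_multiples:
  assumes K: "add_subgroup K"
  obtains r :: rat where "\<And>k::int. k \<in> K \<Longrightarrow> of_int k * r \<in> \<int>" "1 \<notin> K \<Longrightarrow> r \<notin> \<int>"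
proof (cases "\<exists>n::nat. n > 0 \<and> int n \<in> K")
  case False
  have "k = 0" if "k \<in> K" for k
  proof (rule ccontr)
    assume "k \<noteq> 0"
    moreover have "- k \<in> K" using K that by (rule add_subgroup_minus)
    ultimately have "nat \<bar>k\<bar> > 0" "int (nat \<bar>k\<bar>) \<in> K" using that by (auto simp: abs_if)
    then show False using False by blast
  qed
  moreover have "(1/2::rat) \<notin> \<int>"
  proof
    assume "(1/2::rat) \<in> \<int>"
    then obtain m where "(1/2::rat) = of_int m" by (auto elim: Ints_cases)
    then have "of_int (2 * m) = (of_int 1 :: rat)" by simp
    then have "2 * m = 1" by (simp only: of_int_eq_iff)
    then show False by presburger
  qed
  ultimately show thesis by (intro that[of "1/2"]) force+
next
  case True
  define n where "n = (LEAST n::nat. n > 0 \<and> int n \<in> K)"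
  have n: "n > 0" "int n \<in> K" and least: "\<And>m::nat. m > 0 \<Longrightarrow> int m \<in> K \<Longrightarrow> n \<le> m"
    using LeastI_ex[OF True] Least_le[of "\<lambda>n. n > 0 \<and> int n \<in> K"] by (auto simp: n_def)
  have dvd: "int n dvd k" if "k \<in> K" for k
  proof -
    have "int n * (k div int n) \<in> K"
      by (rule int_multiple_in_add_subgroup[OF K, of "\<lambda>j. int n * j"])
        (use n in \<open>auto simp: additive_on_def algebra_simps\<close>)
    then have "k mod int n \<in> K"
      by (metis add_subgroup_diff[OF K that] minus_mult_div_eq_mod)
    moreover have "0 \<le> k mod int n" "k mod int n < int n" using n by auto
    ultimately have "k mod int n = 0"
      using least[of "nat (k mod int n)"] by force
    then show ?thesis by auto
  qed
  show thesis
  proof (rule that[of "1 / of_nat n"])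
    fix k assume "k \<in> K"
    then obtain j where "k = int n * j" using dvd by auto
    then show "of_int k * (1 / of_nat n :: rat) \<in> \<int>" using n by auto
  next
    assume "1 \<notin> K"
    then have "n > 1" using n by (cases "n = 1") auto
    show "(1 / of_nat n :: rat) \<notin> \<int>"
    proof
      assume "(1 / of_nat n :: rat) \<in> \<int>"
      then obtain m where "(1 / of_nat n :: rat) = of_int m" by (auto elim: Ints_cases)
      then have "of_int (int n * m) = (of_int 1 :: rat)" using n by (simp add: field_simps)
      then have "int n * m = 1" by (simp only: of_int_eq_iff)
      then have "int n = 1" using zmult_eq_1_iff by auto
      then show False using \<open>n > 1\<close> by simp
    qed
  qed
qed

text \<open>\<open>R\<close> is read as the graph of a partial homomorphism whose ambiguity, the
  fibre over 0, stays inside \<open>J\<close>: for \<open>J = {0}\<close> the values are in \<rat>,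
  for \<open>J = \<int>\<close> in \<rat>/\<int>. Zorn's lemma gives a maximal graph, and
  divisibility of \<rat> allows a graph to be extended to any further element.\<close>

lemma ex_total_extension:
  fixes R :: "(('c \<Rightarrow>\<^sub>0 int) \<times> rat) set"
  assumes R: "add_subgroup R" and RJ: "\<And>y. (0, y) \<in> R \<Longrightarrow> y \<in> J"
  shows "\<exists>M. add_subgroup M \<and> R \<subseteq> M \<and> (\<forall>y. (0, y) \<in> M \<longrightarrow> y \<in> J) \<and> (\<forall>x. \<exists>y. (x, y) \<in> M)"
proof -
  define \<A> where "\<A> = {M. add_subgroup M \<and> R \<subseteq> M \<and> (\<forall>y. (0, y) \<in> M \<longrightarrow> y \<in> J)}"
  have "\<exists>M\<in>\<A>. \<forall>X\<in>\<A>. M \<subseteq> X \<longrightarrow> X = M"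
  proof (rule subset_Zorn_nonempty)
    show "\<A> \<noteq> {}" using assms by (auto simp: \<A>_def)
    fix \<C> assume ne: "\<C> \<noteq> {}" and "subset.chain \<A> \<C>"
    then have sub: "\<C> \<subseteq> \<A>" and lin: "\<And>S T. S \<in> \<C> \<Longrightarrow> T \<in> \<C> \<Longrightarrow> S \<subseteq> T \<or> T \<subseteq> S"
      by (auto simp: subset_chain_def)
    have "x - y \<in> \<Union>\<C>" if xy: "x \<in> \<Union>\<C>" "y \<in> \<Union>\<C>" for x y
    proof -
      from xy obtain S T where ST: "S \<in> \<C>" "x \<in> S" "T \<in> \<C>" "y \<in> T" by auto
      then obtain U where "U \<in> \<C>" "x \<in> U" "y \<in> U" using lin[of S T] by blast
      moreover from this have "x - y \<in> U" using sub by (auto simp: \<A>_def intro: add_subgroup_diff)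
      ultimately show ?thesis by blast
    qed
    moreover obtain S where "S \<in> \<C>" "0 \<in> S" "R \<subseteq> S"
      using sub ne by (auto simp: \<A>_def add_subgroup_def)
    moreover have "y \<in> J" if "(0, y) \<in> \<Union>\<C>" for y
      using that sub by (auto simp: \<A>_def)
    ultimately show "\<Union>\<C> \<in> \<A>"
      unfolding \<A>_def add_subgroup_def by blast
  qed
  then obtain M where M: "add_subgroup M" "R \<subseteq> M" and MJ: "\<And>y. (0, y) \<in> M \<Longrightarrow> y \<in> J"
    and max: "\<And>X. X \<in> \<A> \<Longrightarrow> M \<subseteq> X \<Longrightarrow> X = M"
    by (auto simp: \<A>_def)
  have "\<exists>y. (x, y) \<in> M" for x
  proof -
    \<comment> \<open>\<open>r\<close> is an admissible value at \<open>x\<close>: it is forced on those multiples of \<open>x\<close> which already have one.\<close>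
    obtain r :: rat where r: "\<And>k b. (frag_cmul k x, b) \<in> M \<Longrightarrow> (0, b - of_int k * r) \<in> M"
    proof (cases "\<exists>n b. n > 0 \<and> (frag_cmul (int n) x, b) \<in> M")
      case False
      have "k = 0" if "(frag_cmul k x, b) \<in> M" for k b
      proof (rule ccontr)
        assume "k \<noteq> 0"
        moreover have "(frag_cmul (-k) x, - b) \<in> M"
          using add_subgroup_minus[OF M(1) that] by simp
        ultimately have "\<exists>b. nat \<bar>k\<bar> > 0 \<and> (frag_cmul (int (nat \<bar>k\<bar>)) x, b) \<in> M"
          using that by (cases "k > 0") auto
        then show False using False by blast
      qed
      then show ?thesis by (intro that[of 0]) force
    next
      case True
      define n where "n = (LEAST n::nat. n > 0 \<and> (\<exists>b. (frag_cmul (int n) x, b) \<in> M))"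
      have "n > 0 \<and> (\<exists>b. (frag_cmul (int n) x, b) \<in> M)"
        unfolding n_def by (rule LeastI_ex) (use True in blast)
      then obtain y where n: "n > 0" and y: "(frag_cmul (int n) x, y) \<in> M" by blast
      have least: "n \<le> m" if "m > 0" "(frag_cmul (int m) x, b) \<in> M" for m b
        unfolding n_def by (rule Least_le) (use that in blast)
      show ?thesis
      \<comment> \<open>By minimality of \<open>n\<close>, every \<open>k\<close> in question is a
        multiple j n. Then \<open>b\<close> and j y are two values at the same element, so they
        differ by a member of the fibre over 0. Dividing \<open>y\<close> by \<open>n\<close> is
        where divisibility of \<rat> enters.\<close>
      proof (rule that[of "y / of_nat n"])
        fix k b assume kb: "(frag_cmul k x, b) \<in> M"
        define j where "j = k div int n"
        have "(frag_cmul j (frag_cmul (int n) x), of_int j * y) \<in> M"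
          by (rule multiple_pair_in_add_subgroup[OF M(1) y])
        then have *: "(frag_cmul k x - frag_cmul (j * int n) x, b - of_int j * y) \<in> M"
          using add_subgroup_diff[OF M(1) kb] by fastforce
        moreover have "frag_cmul k x - frag_cmul (j * int n) x = frag_cmul (k mod int n) x"
          by (metis frag_cmul_diff_distrib j_def minus_div_mult_eq_mod)
        ultimately have "(frag_cmul (k mod int n) x, b - of_int j * y) \<in> M" by simp
        moreover have "0 \<le> k mod int n" "k mod int n < int n" using n by auto
        ultimately have "k mod int n = 0"
          using least[of "nat (k mod int n)"] by force
        then have "k = j * int n" by (auto simp: j_def)
        then show "(0, b - of_int k * (y / of_nat n)) \<in> M" using * n by simp
      qed
    qed
    \<comment> \<open>\<open>X\<close> is \<open>M\<close> with the pair \<open>(x, r)\<close>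
      adjoined. The choice of \<open>r\<close> keeps the fibre over 0 inside that of
      \<open>M\<close>, so maximality puts the pair into \<open>M\<close>.\<close>
    define h where "h = (\<lambda>(p, k). p + (frag_cmul k x, of_int k * r))"
    define X where "X = h ` (M \<times> UNIV)"
    have "add_subgroup X"
      unfolding X_def
    proof (rule add_subgroup_image)
      show "add_subgroup (M \<times> (UNIV :: int set))" using M by (auto simp: add_subgroup_def zero_prod_def)
      show "additive_on (M \<times> UNIV) h"
        by (auto simp: additive_on_def h_def frag_cmul_distrib algebra_simps)
    qed
    moreover have "M \<subseteq> X"
    proof
      fix p assume "p \<in> M"
      then have "h (p, 0) \<in> X" by (auto simp: X_def)
      then show "p \<in> X" by (simp add: h_def flip: zero_prod_def)
    qed
    moreover have "y \<in> J" if "(0, y) \<in> X" for y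
    proof -
      from that obtain a b k where ab: "(a, b) \<in> M" and 0: "0 = a + frag_cmul k x" and y: "y = b + of_int k * r"
        by (auto simp: X_def h_def)
      from 0 have "a = frag_cmul (- k) x" by (metis add_diff_cancel_right' diff_0 frag_cmul_diff_distrib frag_cmul_zero)
      then have "(0, y) \<in> M" using r[of "-k" b] ab y by simp
      then show ?thesis by (rule MJ)
    qed
    ultimately have "X = M" using M(2) by (intro max) (auto simp: \<A>_def)
    moreover have "h (0, 1) \<in> X" using M(1) by (auto simp: X_def add_subgroup_def)
    ultimately show ?thesis by (auto simp: h_def zero_prod_def)
  qed
  then have "\<forall>x. \<exists>y. (x, y) \<in> M" ..
  moreover have "\<forall>y. (0, y) \<in> M \<longrightarrow> y \<in> J" using MJ by iprover
  ultimately have "add_subgroup M \<and> R \<subseteq> M \<and> (\<forall>y. (0, y) \<in> M \<longrightarrow> y \<in> J) \<and> (\<forall>x. \<exists>y. (x, y) \<in> M)"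
    using M by (intro conjI)
  then show ?thesis by (rule exI)
qed

text \<open>Injectivity of \<rat> and \<rat>/\<int>: modulo \<open>J\<close>, the map
  \<open>g\<close> factors through \<open>h\<close>, and the factor extends to the whole free
  abelian group. Freeness also allows a homomorphism to \<rat>/\<int> to be lifted to a
  rational-valued one.\<close>

lemma ex_additive_extension:
  fixes h :: "'d::ab_group_add \<Rightarrow> 'c \<Rightarrow>\<^sub>0 int" and g :: "'d \<Rightarrow> rat"
  assumes A: "add_subgroup A" and h: "additive_on A h" and g: "additive_on A g"
    and J: "\<And>x. x \<in> A \<Longrightarrow> h x = 0 \<Longrightarrow> g x \<in> J"
  obtains \<Phi> where "additive_on UNIV \<Phi>" "\<And>x. x \<in> A \<Longrightarrow> \<Phi> (h x) - g x \<in> J"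
proof -
  have "additive_on A (\<lambda>x. (h x, g x))" using h g by (simp add: additive_on_def)
  from add_subgroup_image[OF A this]
  have "\<exists>M. add_subgroup M \<and> (\<lambda>x. (h x, g x)) ` A \<subseteq> M \<and> (\<forall>y. (0, y) \<in> M \<longrightarrow> y \<in> J) \<and> (\<forall>x. \<exists>y. (x, y) \<in> M)"
    by (rule ex_total_extension) (use J in auto)
  then obtain M where M: "add_subgroup M" "(\<lambda>x. (h x, g x)) ` A \<subseteq> M"
    and MJ: "\<And>y. (0, y) \<in> M \<Longrightarrow> y \<in> J" and tot: "\<And>x. \<exists>y. (x, y) \<in> M"
    by iprover
  \<comment> \<open>One admissible value for each free generator; the linear extension stays in
    \<open>M\<close> because \<open>M\<close> is a subgroup.\<close>
  define w where "w s = (SOME y. (frag_of s, y) \<in> M)" for s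
  have w: "(frag_of s, w s) \<in> M" for s
    unfolding w_def using tot by (rule someI_ex)
  define \<Phi> where "\<Phi> c = (\<Sum>s\<in>Poly_Mapping.keys c. of_int (poly_mapping.lookup c s) * w s)" for c
  have \<Phi>: "\<Phi> c = (\<Sum>s\<in>T. of_int (poly_mapping.lookup c s) * w s)"
    if "finite T" "Poly_Mapping.keys c \<subseteq> T" for c T
    unfolding \<Phi>_def by (rule sum.mono_neutral_left) (use that in \<open>auto simp: in_keys_iff\<close>)
  have add: "\<Phi> (a + b) = \<Phi> a + \<Phi> b" for a b
  proof -
    let ?T = "Poly_Mapping.keys a \<union> Poly_Mapping.keys b"
    have "Poly_Mapping.keys (a + b) \<subseteq> ?T" by (rule keys_add)
    then have "\<Phi> (a + b) = (\<Sum>s\<in>?T. of_int (poly_mapping.lookup (a + b) s) * w s)"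
      by (intro \<Phi>) auto
    also have "\<dots> = (\<Sum>s\<in>?T. of_int (poly_mapping.lookup a s) * w s) + (\<Sum>s\<in>?T. of_int (poly_mapping.lookup b s) * w s)"
      by (simp only: lookup_add of_int_add distrib_right sum.distrib)
    also have "\<dots> = \<Phi> a + \<Phi> b"
      by (intro arg_cong2[of _ _ _ _ "(+)"] \<Phi>[symmetric]) auto
    finally show ?thesis .
  qed
  then have \<Phi>add: "additive_on UNIV \<Phi>" by (simp add: additive_on_def)
  have \<Phi>M: "(c, \<Phi> c) \<in> M" for c
  proof (rule frag_induction[of c UNIV])
    show "Poly_Mapping.keys c \<subseteq> UNIV" by simp
    show "(0, \<Phi> 0) \<in> M" using M(1) by (simp add: \<Phi>_def add_subgroup_def flip: zero_prod_def)
    show "(frag_of s, \<Phi> (frag_of s)) \<in> M" for s using w by (simp add: \<Phi>_def)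
    show "(a - b, \<Phi> (a - b)) \<in> M" if "(a, \<Phi> a) \<in> M" "(b, \<Phi> b) \<in> M" for a b
      using add_subgroup_diff[OF M(1) that] additive_on_diff[OF _ \<Phi>add]
      by (simp add: add_subgroup_def)
  qed
  show thesis
  proof (rule that[OF \<Phi>add])
    fix x assume "x \<in> A"
    then have "(h x, g x) \<in> M" using M by auto
    then have "(0, \<Phi> (h x) - g x) \<in> M" using add_subgroup_diff[OF M(1) \<Phi>M[of "h x"]] by force
    then show "\<Phi> (h x) - g x \<in> J" by (rule MJ)
  qed
qed

lemma ex_rat_extension:
  fixes \<theta> :: "('c \<Rightarrow>\<^sub>0 int) \<Rightarrow> rat"
  assumes "add_subgroup A" "additive_on A \<theta>"
  obtains \<Phi> where "additive_on UNIV \<Phi>" "\<And>x. x \<in> A \<Longrightarrow> \<Phi> x = \<theta> x"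
proof -
  have "additive_on A (\<lambda>x. x)" by (simp add: additive_on_def)
  moreover have "\<theta> x \<in> {0}" if "x = 0" for x
    using that additive_on_0[OF assms] by simp
  ultimately obtain \<Phi> where "additive_on UNIV \<Phi>" "\<And>x. x \<in> A \<Longrightarrow> \<Phi> x - \<theta> x \<in> {0}"
    using ex_additive_extension[OF assms(1) _ assms(2), of "\<lambda>x. x" "{0}"] by blast
  then show thesis by (intro that[of \<Phi>]) auto
qed

text \<open>\<rat>/\<int> is a cogenerator: a character of the cyclic group generated by
  \<open>z\<close> modulo \<open>A\<close>, nontrivial at \<open>z\<close>, extends to the whole
  group.\<close>

lemma ex_additive_separating:
  fixes A :: "('c \<Rightarrow>\<^sub>0 int) set"
  assumes A: "add_subgroup A" and z: "z \<notin> A"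
  obtains \<Phi> :: "_ \<Rightarrow> rat" where "additive_on UNIV \<Phi>" "\<And>a. a \<in> A \<Longrightarrow> \<Phi> a \<in> \<int>" "\<Phi> z \<notin> \<int>"
proof -
  have "add_subgroup {k. frag_cmul k z \<in> A}"
    unfolding add_subgroup_def[of "Collect _"]
    using add_subgroup_0[OF A] add_subgroup_diff[OF A] by (simp add: frag_cmul_diff_distrib)
  then obtain r :: rat where r: "\<And>k. frag_cmul k z \<in> A \<Longrightarrow> of_int k * r \<in> \<int>" and r': "r \<notin> \<int>"
    using ex_rat_annihilating_multiples z by (metis frag_cmul_one mem_Collect_eq)
  \<comment> \<open>Working on \<open>A \<times> UNIV\<close> replaces the check that a + k z
    \<mapsto> k r is well defined modulo \<int> by a condition on the kernel of
    \<open>h\<close>.\<close>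
  define h where "h = (\<lambda>(a, k). a + frag_cmul k z)"
  define g where "g = (\<lambda>(a::'c \<Rightarrow>\<^sub>0 int, k). of_int k * r)"
  have A': "add_subgroup (A \<times> (UNIV :: int set))" using A by (auto simp: add_subgroup_def zero_prod_def)
  have "additive_on (A \<times> UNIV) h" "additive_on (A \<times> UNIV) g"
    by (auto simp: additive_on_def h_def g_def frag_cmul_distrib algebra_simps)
  moreover have "g x \<in> \<int>" if "x \<in> A \<times> UNIV" "h x = 0" for x
  proof -
    obtain a k where x: "x = (a, k)" by (cases x)
    with that have "frag_cmul k z = - a" "a \<in> A" by (auto simp: h_def add_eq_0_iff)
    then have "frag_cmul k z \<in> A" using add_subgroup_minus[OF A] by simp
    then show ?thesis using r x by (simp add: g_def)
  qed
  ultimately obtain \<Phi> where \<Phi>: "additive_on UNIV \<Phi>" "\<And>x. x \<in> A \<times> UNIV \<Longrightarrow> \<Phi> (h x) - g x \<in> \<int>"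
    using ex_additive_extension[OF A'] by metis
  show thesis
  proof (rule that[OF \<Phi>(1)])
    show "\<Phi> a \<in> \<int>" if "a \<in> A" for a
      using \<Phi>(2)[of "(a, 0)"] that by (simp add: h_def g_def)
    have "\<Phi> z - r \<in> \<int>" using \<Phi>(2)[of "(0, 1)"] add_subgroup_0[OF A] by (simp add: h_def g_def)
    then show "\<Phi> z \<notin> \<int>" using r' by (metis Ints_diff diff_diff_eq2 add_diff_cancel_left')
  qed
qed

section \<open>Linear dependence over a field\<close>

text \<open>Gaussian elimination, with \<open>v i s\<close> as coordinate \<open>s\<close> of vector
  \<open>i\<close>. It supplies the dimension count for rational classes.\<close>

lemma ex_nontrivial_relation:
  fixes v :: "'i \<Rightarrow> 's \<Rightarrow> 'k::field"
  assumes "finite S" "finite I" "card S < card I"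
  shows "\<exists>a. (\<exists>i\<in>I. a i \<noteq> 0) \<and> (\<forall>s\<in>S. (\<Sum>i\<in>I. a i * v i s) = 0)"
  using assms
proof (induction S arbitrary: I v rule: finite_induct)
  case empty
  then have "I \<noteq> {}" by auto
  then obtain i where "i \<in> I" by blast
  then show ?case by (intro exI[of _ "\<lambda>_. 1"]) auto
next
  case (insert s S)
  show ?case
  proof (cases "\<forall>i\<in>I. v i s = 0")
    case True
    moreover have "card S < card I" using insert.prems insert.hyps by simp
    ultimately show ?thesis using insert.IH[of I v] insert.prems(1) by fastforce
  next
    case False
    then obtain j where j: "j \<in> I" "v j s \<noteq> 0" by blast
    \<comment> \<open>\<open>w\<close> eliminates coordinate \<open>s\<close> with pivot
      \<open>v j s\<close>; the coefficient of \<open>j\<close> in \<open>b\<close> below collects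
      the subtracted multiples.\<close>
    define w where "w i t = v i t - v i s / v j s * v j t" for i t
    have "card S < card (I - {j})" using insert.hyps insert.prems j by simp
    then obtain a where a: "\<exists>i\<in>I - {j}. a i \<noteq> 0" "\<And>t. t \<in> S \<Longrightarrow> (\<Sum>i\<in>I - {j}. a i * w i t) = 0"
      using insert.IH[of "I - {j}" w] insert.prems by blast
    define b where "b = a(j := - (\<Sum>i\<in>I - {j}. a i * (v i s / v j s)))"
    have b: "(\<Sum>i\<in>I. b i * v i t) = (\<Sum>i\<in>I - {j}. a i * w i t)" for t
    proof -
      have "(\<Sum>i\<in>I. b i * v i t) = b j * v j t + (\<Sum>i\<in>I - {j}. b i * v i t)"
        using j insert.prems by (simp add: sum.remove)
      also have "(\<Sum>i\<in>I - {j}. b i * v i t) = (\<Sum>i\<in>I - {j}. a i * v i t)"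
        by (rule sum.cong) (auto simp: b_def)
      finally show ?thesis
        by (simp add: b_def w_def algebra_simps sum_subtractf sum_distrib_left)
    qed
    have "w i s = 0" for i using j by (simp add: w_def)
    then have "(\<Sum>i\<in>I. b i * v i t) = 0" if "t \<in> insert s S" for t
      using that a(2) by (auto simp: b)
    moreover have "\<exists>i\<in>I. b i \<noteq> 0" using a(1) by (auto simp: b_def)
    ultimately show ?thesis by blast
  qed
qed

section \<open>Endomorphisms of chain complexes\<close>

text \<open>Each \<open>C p\<close> is a subgroup of one ambient free abelian group, on which
  homomorphisms can be defined by their values at generators.\<close>

locale chain_endomorphism =
  fixes C :: "nat \<Rightarrow> ('c \<Rightarrow>\<^sub>0 int) set"
    and d f :: "nat \<Rightarrow> ('c \<Rightarrow>\<^sub>0 int) \<Rightarrow> ('c \<Rightarrow>\<^sub>0 int)"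
  assumes C: "add_subgroup (C p)"
    and d_add: "additive_on (C p) (d p)"
    and f_add: "additive_on (C p) (f p)"
    and d_in: "c \<in> C p \<Longrightarrow> d p c \<in> C (p - 1)"
    and f_in: "c \<in> C p \<Longrightarrow> f p c \<in> C p"
    and dd: "c \<in> C (Suc p) \<Longrightarrow> d p (d (Suc p) c) = 0"
    and fd: "c \<in> C p \<Longrightarrow> d p (f p c) = f (p - 1) (d p c)"
begin

section \<open>Cycles, integral cochains and rational classes\<close>

definition cycles where "cycles p = {c \<in> C p. d p c = 0}"

definition boundaries where "boundaries p = d (Suc p) ` C (Suc p)"

text \<open>
  Integral cochains are encoded as rational-valued functions, so that they can be divided and
  compared with rational cochains. In degree \<open>0\<close> truncated subtraction turns \<open>C (p - 1)\<close> into \<open>C 0\<close>;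
  this is harmless when \<open>d 0 = 0\<close>.
\<close>

definition int_cochain :: "nat \<Rightarrow> (('c \<Rightarrow>\<^sub>0 int) \<Rightarrow> rat) \<Rightarrow> bool" where
  "int_cochain p \<phi> \<longleftrightarrow> additive_on (C p) \<phi> \<and> \<phi> ` C p \<subseteq> \<int>"

definition int_cocycle where
  "int_cocycle p \<phi> \<longleftrightarrow> int_cochain p \<phi> \<and> (\<forall>c\<in>C (Suc p). \<phi> (d (Suc p) c) = 0)"

text \<open>Phrased with cocycles and explicit primitives, so that the diagram chases need no
  quotient groups.\<close>

definition cohom_injective where
  "cohom_injective p \<longleftrightarrow>
     (\<forall>\<beta> \<psi>. int_cocycle p \<beta> \<longrightarrow> int_cochain (p - 1) \<psi> \<longrightarrow> (\<forall>c\<in>C p. \<beta> (f p c) = \<psi> (d p c)) \<longrightarrow>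
        (\<exists>\<psi>'. int_cochain (p - 1) \<psi>' \<and> (\<forall>c\<in>C p. \<beta> c = \<psi>' (d p c))))"

definition cohom_surjective where
  "cohom_surjective p \<longleftrightarrow>
     (\<forall>\<gamma>. int_cocycle p \<gamma> \<longrightarrow>
        (\<exists>\<gamma>' \<psi>. int_cocycle p \<gamma>' \<and> int_cochain (p - 1) \<psi> \<and> (\<forall>c\<in>C p. \<gamma> c = \<gamma>' (f p c) + \<psi> (d p c))))"

text \<open>Finite generation of homology as an induction rule: a property that defines a subgroup
  holds on all cycles once it holds on \<open>S\<close> and on the boundaries.\<close>

definition homology_generated_by where
  "homology_generated_by p S \<longleftrightarrow>
     finite S \<and> S \<subseteq> cycles p \<and>
     (\<forall>A. add_subgroup A \<longrightarrow> S \<subseteq> A \<longrightarrow> boundaries p \<subseteq> A \<longrightarrow> cycles p \<subseteq> A)"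

text \<open>Encodes a homomorphism from the \<open>p\<close>-th homology group to \<open>\<rat>\<close>.\<close>

definition rat_class :: "nat \<Rightarrow> (('c \<Rightarrow>\<^sub>0 int) \<Rightarrow> rat) \<Rightarrow> bool" where
  "rat_class p \<theta> \<longleftrightarrow> additive_on (cycles p) \<theta> \<and> (\<forall>b\<in>boundaries p. \<theta> b = 0)"

lemma cycles_subset: "cycles p \<subseteq> C p"
  by (auto simp: cycles_def)

lemma cycles: "add_subgroup (cycles p)"
  using add_subgroup_vimage[OF C d_add add_subgroup_zero] by (simp add: cycles_def)

lemma boundaries: "add_subgroup (boundaries p)"
  unfolding boundaries_def by (rule add_subgroup_image[OF C d_add])

lemma boundaries_subset_cycles: "boundaries p \<subseteq> cycles p"
  using d_in[of _ "Suc p"] dd by (auto simp: boundaries_def cycles_def)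

lemma f_0: "f p 0 = 0"
  by (rule additive_on_0[OF C f_add])

lemma f_in_cycles: "c \<in> cycles p \<Longrightarrow> f p c \<in> cycles p"
  using f_in fd f_0 by (simp add: cycles_def)

lemma additive_on_comp_d:
  "additive_on (C (p - 1)) h \<Longrightarrow> additive_on (C p) (\<lambda>c. h (d p c))"
  using d_add d_in by (simp add: additive_on_def)

lemma additive_on_comp_f:
  "additive_on (C p) h \<Longrightarrow> additive_on (C p) (\<lambda>c. h (f p c))"
  using f_add f_in by (simp add: additive_on_def)

lemma additive_on_C_cycles: "additive_on (C p) h \<Longrightarrow> additive_on (cycles p) h"
  by (rule additive_on_subset[OF _ cycles_subset])

section \<open>Bijectivity with coefficients in \<rat>\<close>

text \<open>Modulo \<int>, the cochain \<Phi> vanishes on the kernel of \<open>d p\<close>, hence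
  factors through \<open>d p\<close>; injectivity of \<rat>/\<int> extends the factor to
  \<Psi>.\<close>

lemma ex_integral_correction:
  fixes \<Phi> :: "_ \<Rightarrow> rat"
  assumes "additive_on (C p) \<Phi>" "\<And>z. z \<in> cycles p \<Longrightarrow> \<Phi> z \<in> \<int>"
  obtains \<Psi> where "additive_on UNIV \<Psi>" "int_cochain p (\<lambda>c. \<Phi> c - \<Psi> (d p c))"
proof -
  obtain \<Psi> where \<Psi>: "additive_on UNIV \<Psi>" "\<And>c. c \<in> C p \<Longrightarrow> \<Psi> (d p c) - \<Phi> c \<in> \<int>"
    using ex_additive_extension[OF C d_add assms(1), of "\<int>"] assms(2) unfolding cycles_def by blast
  have "\<Phi> c - \<Psi> (d p c) \<in> \<int>" if "c \<in> C p" for c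
    using Ints_minus[OF \<Psi>(2)[OF that]] by simp
  moreover have "additive_on (C p) (\<lambda>c. \<Phi> c - \<Psi> (d p c))"
    using assms(1) additive_on_comp_d[OF additive_on_subset[OF \<Psi>(1)]]
    by (simp add: additive_on_def)
  ultimately show thesis
    by (intro that[OF \<Psi>(1)]) (auto simp: int_cochain_def)
qed

text \<open>A product of denominators of the values at the finitely many generators serves for all
  cycles, since integrality of the multiple defines a subgroup.\<close>

lemma ex_common_denominator:
  assumes "homology_generated_by p S" "rat_class p \<theta>"
  obtains D :: nat where "D > 0" "\<And>z. z \<in> cycles p \<Longrightarrow> of_nat D * \<theta> z \<in> \<int>"
proof -
  have "finite S" using assms(1) by (simp add: homology_generated_by_def)
  then have "\<exists>D::nat. D > 0 \<and> (\<forall>s\<in>S. of_nat D * \<theta> s \<in> \<int>)"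
  proof (induction S rule: finite_induct)
    case (insert s S)
    then obtain D :: nat where D: "D > 0" "\<And>s. s \<in> S \<Longrightarrow> of_nat D * \<theta> s \<in> \<int>" by blast
    obtain a b where ab: "\<theta> s = of_int a / of_int b" "b > 0"
      by (metis quotient_of_div quotient_of_denom_pos surj_pair)
    have "of_nat (D * nat b) * \<theta> s \<in> \<int>"
      using ab by simp
    moreover have "of_nat (D * nat b) * \<theta> t \<in> \<int>" if "t \<in> S" for t
    proof -
      have "of_nat (D * nat b) * \<theta> t = of_nat (nat b) * (of_nat D * \<theta> t)" by simp
      then show ?thesis using D(2)[OF that] by (simp only: Ints_mult Ints_of_nat)
    qed
    ultimately show ?case using D ab by (intro exI[of _ "D * nat b"]) auto
  qed (auto intro: exI[of _ 1])
  then obtain D :: nat where D: "D > 0" "\<And>s. s \<in> S \<Longrightarrow> of_nat D * \<theta> s \<in> \<int>" by blast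
  have "additive_on (cycles p) (\<lambda>z. of_nat D * \<theta> z)"
    using assms(2) by (simp add: additive_on_def rat_class_def distrib_left)
  from add_subgroup_vimage[OF cycles this add_subgroup_Ints]
  have "add_subgroup {z \<in> cycles p. of_nat D * \<theta> z \<in> \<int>}" .
  moreover have "S \<subseteq> {z \<in> cycles p. of_nat D * \<theta> z \<in> \<int>}"
    using D assms(1) by (auto simp: homology_generated_by_def)
  moreover have "boundaries p \<subseteq> {z \<in> cycles p. of_nat D * \<theta> z \<in> \<int>}"
    using assms(2) boundaries_subset_cycles by (auto simp: rat_class_def)
  ultimately have "cycles p \<subseteq> {z \<in> cycles p. of_nat D * \<theta> z \<in> \<int>}"
    using assms(1) unfolding homology_generated_by_def by blast
  then show thesis using D(1) by (intro that[of D]) auto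
qed

text \<open>A multiple of \<theta> is integral on cycles. Extended to all chains and corrected by a
  term in \<open>d p\<close>, it becomes an integral cocycle, to which surjectivity on integral
  cohomology applies; division by \<open>D\<close> undoes the scaling. Terms in \<open>d p\<close>
  vanish on cycles.\<close>

lemma rat_class_surjective:
  assumes fg: "homology_generated_by p S" and surj: "cohom_surjective p" and \<theta>: "rat_class p \<theta>"
  obtains \<theta>' where "rat_class p \<theta>'" "\<And>z. z \<in> cycles p \<Longrightarrow> \<theta> z = \<theta>' (f p z)"
proof -
  obtain D :: nat where D: "D > 0" "\<And>z. z \<in> cycles p \<Longrightarrow> of_nat D * \<theta> z \<in> \<int>"
    using ex_common_denominator[OF fg \<theta>] by blast
  have "additive_on (cycles p) (\<lambda>z. of_nat D * \<theta> z)"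
    using \<theta> by (simp add: additive_on_def rat_class_def distrib_left)
  then obtain \<Phi> where \<Phi>: "additive_on UNIV \<Phi>" "\<And>z. z \<in> cycles p \<Longrightarrow> \<Phi> z = of_nat D * \<theta> z"
    using ex_rat_extension[OF cycles] by metis
  obtain \<Psi> where \<Psi>: "additive_on UNIV \<Psi>" "int_cochain p (\<lambda>c. \<Phi> c - \<Psi> (d p c))"
    using ex_integral_correction[of p \<Phi>] \<Phi> D additive_on_subset by (metis subset_UNIV)
  define \<gamma> where "\<gamma> = (\<lambda>c. \<Phi> c - \<Psi> (d p c))"
  have \<Psi>0: "\<Psi> 0 = 0" using additive_on_0[OF _ \<Psi>(1)] by (simp add: add_subgroup_def)
  have \<gamma>: "\<gamma> z = of_nat D * \<theta> z" if "z \<in> cycles p" for z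
    using that \<Phi>(2)[OF that] \<Psi>0 by (simp add: \<gamma>_def cycles_def)
  have "\<gamma> (d (Suc p) c) = 0" if "c \<in> C (Suc p)" for c
  proof -
    have b: "d (Suc p) c \<in> boundaries p" using that by (simp add: boundaries_def)
    then have "\<theta> (d (Suc p) c) = 0" using \<theta> by (simp add: rat_class_def)
    then show ?thesis using \<gamma>[OF subsetD[OF boundaries_subset_cycles b]] by simp
  qed
  then have "int_cocycle p \<gamma>" using \<Psi>(2) by (simp add: int_cocycle_def \<gamma>_def)
  then obtain \<gamma>' \<psi> where \<gamma>': "int_cocycle p \<gamma>'" "int_cochain (p - 1) \<psi>"
    and eq: "\<And>c. c \<in> C p \<Longrightarrow> \<gamma> c = \<gamma>' (f p c) + \<psi> (d p c)"
    using surj unfolding cohom_surjective_def by blast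
  have \<psi>0: "\<psi> 0 = 0" using \<gamma>'(2) additive_on_0[OF C] by (auto simp: int_cochain_def)
  show thesis
  proof (rule that[of "\<lambda>z. \<gamma>' z / of_nat D"])
    show "rat_class p (\<lambda>z. \<gamma>' z / of_nat D)"
      using \<gamma>'(1) additive_on_C_cycles[of p \<gamma>']
      by (auto simp: rat_class_def int_cocycle_def int_cochain_def additive_on_def boundaries_def add_divide_distrib)
    show "\<theta> z = \<gamma>' (f p z) / of_nat D" if "z \<in> cycles p" for z
      using \<gamma>[OF that] eq[of z] that D(1) \<psi>0 by (simp add: cycles_def field_simps)
  qed
qed

text \<open>
  A surjective endomorphism of a finite-dimensional space is injective: if \<open>\<theta> \<noteq> 0\<close> is in the kernel,
  iterated preimages of \<open>\<theta>\<close> are linearly independent.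
\<close>

lemma rat_class_injective:
  assumes fg: "homology_generated_by p S" and surj: "cohom_surjective p" and \<theta>: "rat_class p \<theta>"
    and ker: "\<And>z. z \<in> cycles p \<Longrightarrow> \<theta> (f p z) = 0" and z0: "z0 \<in> cycles p"
  shows "\<theta> z0 = 0"
proof -
  have "\<exists>\<theta>'. rat_class p \<theta>' \<and> (\<forall>z\<in>cycles p. \<theta>0 z = \<theta>' (f p z))" if "rat_class p \<theta>0" for \<theta>0
    using rat_class_surjective[OF fg surj that] by metis
  \<comment> \<open>\<open>t (Suc n)\<close> is a preimage of \<open>t n\<close> under pullback
    along \<open>f\<close>, starting from \<theta>.\<close>
  then obtain t where "\<forall>n. (rat_class p (t n) \<and> (n = 0 \<longrightarrow> t n = \<theta>)) \<and> (\<forall>z\<in>cycles p. t n z = t (Suc n) (f p z))"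
    using dependent_nat_choice[of "\<lambda>n \<phi>. rat_class p \<phi> \<and> (n = 0 \<longrightarrow> \<phi> = \<theta>)"
        "\<lambda>_ \<phi> \<phi>'. \<forall>z\<in>cycles p. \<phi> z = \<phi>' (f p z)"] \<theta> by auto
  then have t0: "t 0 = \<theta>" and t: "\<And>n. rat_class p (t n)"
    and tS: "\<And>n z. z \<in> cycles p \<Longrightarrow> t n z = t (Suc n) (f p z)"
    by auto
  let ?n = "card S"
  have S: "finite S" "S \<subseteq> cycles p" using fg by (auto simp: homology_generated_by_def)
  \<comment> \<open>There is one function more than there are generators, so their values on
    \<open>S\<close> satisfy a nontrivial relation, which then spreads to all cycles.\<close>
  obtain a where a: "\<exists>k\<in>{..?n}. a k \<noteq> 0" "\<And>s. s \<in> S \<Longrightarrow> (\<Sum>k\<le>?n. a k * t k s) = 0"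
    using ex_nontrivial_relation[OF S(1), of "{..?n}" t] by auto
  \<comment> \<open>\<open>F j\<close> is the relation after \<open>j\<close> pullbacks along
    \<open>f\<close>: the indices drop by \<open>j\<close>, and the terms with \<open>k < j\<close>
    have disappeared because \<theta> pulls back to 0.\<close>
  define F where "F j z = (\<Sum>k=j..?n. a k * t (k - j) z)" for j z
  have "rat_class p (F 0)"
    using t by (auto simp: rat_class_def F_def additive_on_def distrib_left sum.distrib)
  then have "additive_on (cycles p) (F 0)" and B: "\<And>b. b \<in> boundaries p \<Longrightarrow> F 0 b = 0"
    by (auto simp: rat_class_def)
  from add_subgroup_vimage[OF cycles this(1) add_subgroup_zero]
  have "add_subgroup {z \<in> cycles p. F 0 z \<in> {0}}" .
  moreover have "S \<subseteq> {z \<in> cycles p. F 0 z \<in> {0}}"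
    using a(2) S(2) by (auto simp: F_def atLeast0AtMost)
  moreover have "boundaries p \<subseteq> {z \<in> cycles p. F 0 z \<in> {0}}"
    using B boundaries_subset_cycles by auto
  ultimately have "cycles p \<subseteq> {z \<in> cycles p. F 0 z \<in> {0}}"
    using fg unfolding homology_generated_by_def by blast
  then have F0: "F 0 z = 0" if "z \<in> cycles p" for z using that by auto
  have F_split: "F j z = a j * \<theta> z + (\<Sum>k=Suc j..?n. a k * t (k - j) z)" if "j \<le> ?n" for j z
    using that by (simp add: F_def sum.atLeast_Suc_atMost t0)
  have F: "j \<le> ?n \<Longrightarrow> z \<in> cycles p \<Longrightarrow> F j z = 0" for j z
  proof (induction j arbitrary: z)
    case (Suc j)
    have "F (Suc j) z = (\<Sum>k=Suc j..?n. a k * t (k - j) (f p z))"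
      unfolding F_def
    proof (rule sum.cong)
      fix k assume "k \<in> {Suc j..?n}"
      then have "k - j = Suc (k - Suc j)" by auto
      then show "a k * t (k - Suc j) z = a k * t (k - j) (f p z)"
        using tS[OF Suc.prems(2)] by simp
    qed simp
    also have "\<dots> = F j (f p z)"
      using F_split[of j "f p z"] Suc.prems ker by simp
    finally show ?case using Suc f_in_cycles by simp
  qed (rule F0)
  \<comment> \<open>At the last nonzero coefficient only the multiple of \<theta> is left.\<close>
  define m where "m = Max {k\<in>{..?n}. a k \<noteq> 0}"
  have "m \<in> {k\<in>{..?n}. a k \<noteq> 0}" unfolding m_def by (rule Max_in) (use a(1) in auto)
  then have m: "m \<le> ?n" "a m \<noteq> 0" by auto
  have "a k = 0" if "k \<in> {Suc m..?n}" for k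
  proof (rule ccontr)
    assume "a k \<noteq> 0"
    then have "k \<le> m" unfolding m_def by (intro Max_ge) (use that in auto)
    then show False using that by simp
  qed
  then have "F m z0 = a m * \<theta> z0" using F_split[OF m(1)] by simp
  then show ?thesis using F[OF m(1) z0] m(2) by simp
qed

section \<open>Bijectivity with coefficients in \<rat>/\<int>\<close>

text \<open>Injectivity half of the five lemma: \<Phi> modulo \<int> is a class with coefficients in
  \<rat>/\<int> whose pullback is trivial.\<close>

lemma rat_cochain_integral_if_pullback_integral:
  fixes \<Phi> :: "('c \<Rightarrow>\<^sub>0 int) \<Rightarrow> rat"
  assumes fg: "homology_generated_by p S" and surj: "cohom_surjective p"
    and inj: "cohom_injective (Suc p)"
    and \<Phi>: "additive_on (C p) \<Phi>" "\<And>b. b \<in> boundaries p \<Longrightarrow> \<Phi> b \<in> \<int>"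
    and \<Phi>f: "\<And>z. z \<in> cycles p \<Longrightarrow> \<Phi> (f p z) \<in> \<int>"
    and z: "z \<in> cycles p"
  shows "\<Phi> z \<in> \<int>"
proof -
  obtain \<Psi> where \<Psi>: "additive_on UNIV \<Psi>" and \<kappa>: "int_cochain p (\<lambda>c. \<Phi> (f p c) - \<Psi> (d p c))"
    using ex_integral_correction[of p "\<lambda>c. \<Phi> (f p c)"] additive_on_comp_f[OF \<Phi>(1)] \<Phi>f by metis
  have \<Psi>0: "\<Psi> 0 = 0" using additive_on_0[OF _ \<Psi>] by (simp add: add_subgroup_def)
  \<comment> \<open>The Bockstein of \<Phi>, integral because \<Phi> is integral on boundaries. Its
    pullback has the integral primitive \<kappa>, so injectivity in degree p + 1 gives \<beta> an
    integral primitive \<psi>.\<close>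
  define \<beta> where "\<beta> = (\<lambda>c. \<Phi> (d (Suc p) c))"
  have \<Phi>0: "\<Phi> 0 = 0" using additive_on_0[OF C \<Phi>(1)] .
  have \<beta>: "int_cocycle (Suc p) \<beta>"
    using additive_on_comp_d[of "Suc p" \<Phi>] \<Phi> dd \<Phi>0
    by (auto simp: int_cocycle_def int_cochain_def \<beta>_def boundaries_def)
  moreover have "\<beta> (f (Suc p) c) = \<Phi> (f p (d (Suc p) c)) - \<Psi> (d p (d (Suc p) c))" if "c \<in> C (Suc p)" for c
    using fd[OF that] dd[OF that] \<Psi>0 by (simp add: \<beta>_def)
  ultimately obtain \<psi> where \<psi>: "int_cochain p \<psi>" "\<And>c. c \<in> C (Suc p) \<Longrightarrow> \<beta> c = \<psi> (d (Suc p) c)"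
    using inj[unfolded cohom_injective_def, rule_format, of \<beta> "\<lambda>c. \<Phi> (f p c) - \<Psi> (d p c)"] \<kappa> by auto
  \<comment> \<open>The pullback of the rational cocycle \<Phi> - \<psi>, made integral by the term
    in \<Psi>.\<close>
  define \<gamma> where "\<gamma> = (\<lambda>c. \<Phi> (f p c) - \<Psi> (d p c) - \<psi> (f p c))"
  have "int_cochain p (\<lambda>c. \<psi> (f p c))"
    using \<psi>(1) additive_on_comp_f f_in by (force simp: int_cochain_def)
  then have "int_cochain p \<gamma>"
    using \<kappa> unfolding int_cochain_def \<gamma>_def additive_on_def image_subset_iff
    by (simp add: Ints_diff)
  moreover have "\<gamma> (d (Suc p) c) = 0" if "c \<in> C (Suc p)" for c
  proof -
    have "\<Phi> (f p (d (Suc p) c)) = \<psi> (f p (d (Suc p) c))"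
      using fd[OF that] \<psi>(2)[OF f_in[OF that]] by (simp add: \<beta>_def)
    then show ?thesis using dd[OF that] \<Psi>0 by (simp add: \<gamma>_def)
  qed
  ultimately have "int_cocycle p \<gamma>" by (simp add: int_cocycle_def)
  then obtain \<gamma>' \<eta> where \<gamma>': "int_cocycle p \<gamma>'" "int_cochain (p - 1) \<eta>"
    and eq: "\<And>c. c \<in> C p \<Longrightarrow> \<gamma> c = \<gamma>' (f p c) + \<eta> (d p c)"
    using surj unfolding cohom_surjective_def by blast
  have \<eta>0: "\<eta> 0 = 0" using \<gamma>'(2) additive_on_0[OF C] by (auto simp: int_cochain_def)
  \<comment> \<open>On cycles the pullback of \<Phi> - \<psi> equals \<gamma>, and hence the
    pullback of \<gamma>'. The rational class \<theta> therefore pulls back to 0 and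
    vanishes.\<close>
  define \<theta> where "\<theta> = (\<lambda>c. \<Phi> c - \<psi> c - \<gamma>' c)"
  have "rat_class p \<theta>"
    unfolding rat_class_def
  proof (intro conjI ballI)
    have "additive_on (C p) \<theta>"
      using \<Phi>(1) \<psi>(1) \<gamma>'(1) by (simp add: \<theta>_def int_cocycle_def int_cochain_def additive_on_def)
    then show "additive_on (cycles p) \<theta>" by (rule additive_on_C_cycles)
    show "\<theta> b = 0" if "b \<in> boundaries p" for b
      using that \<psi>(2) \<gamma>'(1) by (auto simp: \<theta>_def \<beta>_def boundaries_def int_cocycle_def)
  qed
  moreover have "\<theta> (f p c) = 0" if "c \<in> cycles p" for c
    using that eq[of c] \<Psi>0 \<eta>0 by (simp add: \<gamma>_def \<theta>_def cycles_def)
  ultimately have "\<theta> z = 0" using z by (rule rat_class_injective[OF fg surj])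
  then have "\<Phi> z = \<psi> z + \<gamma>' z" by (simp add: \<theta>_def)
  moreover have "\<psi> z \<in> \<int>" "\<gamma>' z \<in> \<int>"
    using subsetD[OF cycles_subset z] \<psi>(1) \<gamma>'(1) by (auto simp: int_cocycle_def int_cochain_def)
  ultimately show ?thesis by simp
qed

text \<open>Surjectivity half of the five lemma: first the Bockstein of \<Phi> is lifted along
  \<open>f\<close>, then the remaining rational class.\<close>

lemma rat_cochain_pullback_lift:
  fixes \<Phi> :: "('c \<Rightarrow>\<^sub>0 int) \<Rightarrow> rat"
  assumes fg: "homology_generated_by p S" and surj: "cohom_surjective p"
    and fg': "homology_generated_by (Suc p) T" and surj': "cohom_surjective (Suc p)"
    and \<Phi>: "additive_on (C p) \<Phi>" "\<And>b. b \<in> boundaries p \<Longrightarrow> \<Phi> b \<in> \<int>"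
  obtains \<Phi>' :: "_ \<Rightarrow> rat" where "additive_on UNIV \<Phi>'" "\<And>b. b \<in> boundaries p \<Longrightarrow> \<Phi>' b \<in> \<int>"
    "\<And>z. z \<in> cycles p \<Longrightarrow> \<Phi>' (f p z) - \<Phi> z \<in> \<int>"
proof -
  define \<beta> where "\<beta> = (\<lambda>c. \<Phi> (d (Suc p) c))"
  have \<Phi>0: "\<Phi> 0 = 0" using additive_on_0[OF C \<Phi>(1)] .
  have \<beta>: "int_cocycle (Suc p) \<beta>"
    using additive_on_comp_d[of "Suc p" \<Phi>] \<Phi> dd \<Phi>0
    by (auto simp: int_cocycle_def int_cochain_def \<beta>_def boundaries_def)
  then obtain \<beta>' \<psi> where \<beta>': "int_cocycle (Suc p) \<beta>'" and \<psi>: "int_cochain p \<psi>"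
    and eq: "\<And>c. c \<in> C (Suc p) \<Longrightarrow> \<beta> c = \<beta>' (f (Suc p) c) + \<psi> (d (Suc p) c)"
    using surj'[unfolded cohom_surjective_def, rule_format, of \<beta>] by auto
  have \<psi>0: "\<psi> 0 = 0" using \<psi> additive_on_0[OF C] by (auto simp: int_cochain_def)
  have \<beta>'add: "additive_on (C (Suc p)) \<beta>'" using \<beta>' by (simp add: int_cocycle_def int_cochain_def)
  have "rat_class (Suc p) \<beta>'"
    using \<beta>' additive_on_C_cycles[OF \<beta>'add] by (auto simp: rat_class_def int_cocycle_def boundaries_def)
  moreover have "\<beta>' (f (Suc p) c) = 0" if "c \<in> cycles (Suc p)" for c
    using that eq[of c] \<psi>0 \<Phi>0 by (simp add: cycles_def \<beta>_def)
  \<comment> \<open>The Bockstein \<beta> vanishes on cycles, so the rational class of its lift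
    \<beta>' pulls back to 0. Hence \<beta>' vanishes on cycles and has a rational primitive
    \<Phi>1.\<close>
  ultimately have \<beta>'0: "\<beta>' c = 0" if "c \<in> C (Suc p)" "d (Suc p) c = 0" for c
    using that rat_class_injective[OF fg' surj'] by (simp add: cycles_def)
  obtain \<Phi>1 where \<Phi>1: "additive_on UNIV \<Phi>1" "\<And>c. c \<in> C (Suc p) \<Longrightarrow> \<Phi>1 (d (Suc p) c) - \<beta>' c \<in> {0}"
    using ex_additive_extension[OF C d_add \<beta>'add, of "{0}"] \<beta>'0 by blast
  \<comment> \<open>\<Phi>1 pulls back to \<Phi> only up to \<psi>, which is integral, and this
    rational cocycle, which is lifted to \<theta>' and subtracted.\<close>
  define \<theta> where "\<theta> = (\<lambda>c. \<Phi>1 (f p c) - \<Phi> c + \<psi> c)"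
  have "rat_class p \<theta>"
    unfolding rat_class_def
  proof (intro conjI ballI)
    have "additive_on (C p) \<theta>"
      using \<Phi>(1) \<psi> additive_on_comp_f[OF additive_on_subset[OF \<Phi>1(1)], of p]
      by (simp add: \<theta>_def int_cochain_def additive_on_def)
    then show "additive_on (cycles p) \<theta>" by (rule additive_on_C_cycles)
    fix b assume "b \<in> boundaries p"
    then obtain c where c: "c \<in> C (Suc p)" "b = d (Suc p) c" by (auto simp: boundaries_def)
    have "\<Phi>1 (f p b) = \<beta>' (f (Suc p) c)"
      using \<Phi>1(2)[OF f_in[OF c(1)]] fd[OF c(1)] c(2) by simp
    then show "\<theta> b = 0" using eq[OF c(1)] c(2) by (simp add: \<theta>_def \<beta>_def)
  qed
  then obtain \<theta>' where \<theta>': "rat_class p \<theta>'" "\<And>z. z \<in> cycles p \<Longrightarrow> \<theta> z = \<theta>' (f p z)"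
    using rat_class_surjective[OF fg surj] by blast
  obtain \<Theta> where \<Theta>: "additive_on UNIV \<Theta>" "\<And>z. z \<in> cycles p \<Longrightarrow> \<Theta> z = \<theta>' z"
    using ex_rat_extension[OF cycles] \<theta>'(1) unfolding rat_class_def by metis
  show thesis
  proof (rule that[of "\<lambda>c. \<Phi>1 c - \<Theta> c"])
    show "additive_on UNIV (\<lambda>c. \<Phi>1 c - \<Theta> c)"
      using \<Phi>1(1) \<Theta>(1) by (simp add: additive_on_def)
    show "\<Phi>1 b - \<Theta> b \<in> \<int>" if b: "b \<in> boundaries p" for b
    proof -
      obtain c where c: "c \<in> C (Suc p)" "b = d (Suc p) c" using b by (auto simp: boundaries_def)
      have "\<Theta> b = 0" using \<Theta>(2) \<theta>'(1) b subsetD[OF boundaries_subset_cycles b] by (simp add: rat_class_def)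
      moreover have "\<Phi>1 b = \<beta>' c" using \<Phi>1(2)[OF c(1)] c(2) by simp
      moreover have "\<beta>' c \<in> \<int>" using \<beta>' c(1) by (auto simp: int_cocycle_def int_cochain_def)
      ultimately show ?thesis by simp
    qed
    show "\<Phi>1 (f p z) - \<Theta> (f p z) - \<Phi> z \<in> \<int>" if "z \<in> cycles p" for z
    proof -
      have "\<Phi>1 (f p z) - \<Theta> (f p z) - \<Phi> z = - \<psi> z"
        using \<Theta>(2)[OF f_in_cycles[OF that]] \<theta>'(2)[OF that] by (simp add: \<theta>_def)
      moreover have "\<psi> z \<in> \<int>" using \<psi> subsetD[OF cycles_subset that] by (auto simp: int_cochain_def)
      ultimately show ?thesis by simp
    qed
  qed
qed

section \<open>From characters to homology\<close>

text \<open>A character that vanishes on the image of \<open>f\<close> and on boundaries has trivial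
  pullback, so it is trivial on cycles; it cannot separate \<open>z\<close> from that
  subgroup.\<close>

theorem homology_surjective:
  assumes fg: "homology_generated_by p S" and surj: "cohom_surjective p"
    and inj: "cohom_injective (Suc p)" and z: "z \<in> cycles p"
  shows "\<exists>z'\<in>cycles p. z - f p z' \<in> boundaries p"
proof (rule ccontr)
  define h where "h = (\<lambda>(c, b). f p c + b)"
  define A where "A = h ` (cycles p \<times> boundaries p)"
  assume "\<not> ?thesis"
  then have "z \<notin> A" by (force simp: A_def h_def algebra_simps)
  moreover have "add_subgroup (cycles p \<times> boundaries p)"
    unfolding add_subgroup_def zero_prod_def
    using add_subgroup_0[OF cycles] add_subgroup_0[OF boundaries]
      add_subgroup_diff[OF cycles] add_subgroup_diff[OF boundaries] by auto
  moreover have "additive_on (cycles p \<times> boundaries p) h"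
    using f_add cycles_subset by (force simp: additive_on_def h_def algebra_simps)
  ultimately obtain \<Phi> :: "_ \<Rightarrow> rat" where \<Phi>: "additive_on UNIV \<Phi>" "\<And>a. a \<in> A \<Longrightarrow> \<Phi> a \<in> \<int>" "\<Phi> z \<notin> \<int>"
    unfolding A_def by (metis add_subgroup_image ex_additive_separating)
  have "c \<in> A" if "c \<in> boundaries p" for c
    using that add_subgroup_0[OF cycles, of p] f_0 by (force simp: A_def h_def image_iff)
  moreover have "f p c \<in> A" if "c \<in> cycles p" for c
    using that add_subgroup_0[OF boundaries, of p] by (force simp: A_def h_def image_iff)
  ultimately have "\<Phi> z \<in> \<int>"
    using \<Phi>(2) rat_cochain_integral_if_pullback_integral[OF fg surj inj additive_on_subset[OF \<Phi>(1)] _ _ z] by blast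
  then show False using \<Phi>(3) by simp
qed

text \<open>A character separating \<open>z\<close> from the boundaries is, modulo \<int>, the
  pullback of some \<Phi>', and \<Phi>' is integral at the boundary \<open>f p z\<close>.\<close>

theorem homology_injective:
  assumes fg: "homology_generated_by p S" and surj: "cohom_surjective p"
    and fg': "homology_generated_by (Suc p) T" and surj': "cohom_surjective (Suc p)"
    and z: "z \<in> cycles p" "f p z \<in> boundaries p"
  shows "z \<in> boundaries p"
proof (rule ccontr)
  assume "z \<notin> boundaries p"
  then obtain \<Phi> :: "_ \<Rightarrow> rat" where \<Phi>: "additive_on UNIV \<Phi>" "\<And>a. a \<in> boundaries p \<Longrightarrow> \<Phi> a \<in> \<int>" "\<Phi> z \<notin> \<int>"
    using ex_additive_separating[OF boundaries] by metis
  obtain \<Phi>' :: "_ \<Rightarrow> rat" where \<Phi>': "\<And>b. b \<in> boundaries p \<Longrightarrow> \<Phi>' b \<in> \<int>"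
      "\<And>z. z \<in> cycles p \<Longrightarrow> \<Phi>' (f p z) - \<Phi> z \<in> \<int>"
    using rat_cochain_pullback_lift[OF fg surj fg' surj' additive_on_subset[OF \<Phi>(1)] \<Phi>(2)] by blast
  have "\<Phi>' (f p z) - (\<Phi>' (f p z) - \<Phi> z) \<in> \<int>"
    by (intro Ints_diff \<Phi>' z)
  then show False using \<Phi>(3) by simp
qed

end

section \<open>Singular cohomology\<close>

lemma cochain_carrier_iff:
  "\<phi> \<in> carrier (cochain_group p X) \<longleftrightarrow>
     additive_on (singular_chain_set p X) \<phi> \<and> \<phi> \<in> extensional (singular_chain_set p X)"
  by (auto simp: cochain_group_def hom_def additive_on_def)

lemma cochain_mult: "\<phi> \<otimes>\<^bsub>cochain_group p X\<^esub> \<psi> = (\<lambda>c\<in>singular_chain_set p X. \<phi> c + \<psi> c)"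
  by (simp add: cochain_group_def)

lemma cochain_one: "\<one>\<^bsub>cochain_group p X\<^esub> = (\<lambda>c\<in>singular_chain_set p X. 0)"
  by (simp add: cochain_group_def)

lemma restrict_in_cochain_group:
  "additive_on (singular_chain_set p X) \<phi> \<Longrightarrow> restrict \<phi> (singular_chain_set p X) \<in> carrier (cochain_group p X)"
  unfolding cochain_carrier_iff by (simp add: additive_on_def singular_chain_add)

lemma group_cochain_group: "group (cochain_group p X)"
proof (rule groupI)
  fix \<phi> assume \<phi>: "\<phi> \<in> carrier (cochain_group p X)"
  have "(\<lambda>c\<in>singular_chain_set p X. - \<phi> c) \<in> carrier (cochain_group p X)"
    using \<phi> by (intro restrict_in_cochain_group) (simp add: cochain_carrier_iff additive_on_def)
  moreover have "(\<lambda>c\<in>singular_chain_set p X. - \<phi> c) \<otimes>\<^bsub>cochain_group p X\<^esub> \<phi> = \<one>\<^bsub>cochain_group p X\<^esub>"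
    by (auto simp: cochain_mult cochain_one)
  ultimately show "\<exists>\<psi>\<in>carrier (cochain_group p X). \<psi> \<otimes>\<^bsub>cochain_group p X\<^esub> \<phi> = \<one>\<^bsub>cochain_group p X\<^esub>" by blast
next
  show "\<phi> \<otimes>\<^bsub>cochain_group p X\<^esub> \<psi> \<in> carrier (cochain_group p X)"
    if "\<phi> \<in> carrier (cochain_group p X)" "\<psi> \<in> carrier (cochain_group p X)" for \<phi> \<psi>
    unfolding cochain_mult
    using that by (intro restrict_in_cochain_group) (simp add: cochain_carrier_iff additive_on_def)
  show "\<one>\<^bsub>cochain_group p X\<^esub> \<in> carrier (cochain_group p X)"
    unfolding cochain_one by (intro restrict_in_cochain_group) (simp add: additive_on_def)
  show "\<one>\<^bsub>cochain_group p X\<^esub> \<otimes>\<^bsub>cochain_group p X\<^esub> \<phi> = \<phi>" if "\<phi> \<in> carrier (cochain_group p X)" for \<phi>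
    using that by (auto simp: cochain_mult cochain_one cochain_carrier_iff fun_eq_iff extensional_def)
qed (auto simp: cochain_mult fun_eq_iff)

lemma group_hom_coboundary: "group_hom (cochain_group p X) (cochain_group (Suc p) X) (coboundary p X)"
proof (intro group_hom.intro group_hom_axioms.intro group_cochain_group homI)
  show "coboundary p X \<phi> \<in> carrier (cochain_group (Suc p) X)" if "\<phi> \<in> carrier (cochain_group p X)" for \<phi>
    unfolding coboundary_def carrier_chain_group
    using that singular_chain_boundary_alt[of p X]
    by (intro restrict_in_cochain_group) (simp add: cochain_carrier_iff additive_on_def chain_boundary_add)
qed (auto simp: coboundary_def cochain_mult fun_eq_iff singular_chain_boundary_alt singular_chain_add)

lemma subgroup_cocycle_set: "subgroup (cocycle_set p X) (cochain_group p X)"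
  unfolding cocycle_set_def by (rule group_hom.subgroup_kernel[OF group_hom_coboundary])

lemma carrier_cocycle_group: "carrier (cocycle_group p X) = cocycle_set p X"
  unfolding cocycle_group_def
  by (rule subgroup.carrier_subgroup_generated_subgroup[OF subgroup_cocycle_set])

lemma mult_cocycle_group: "(\<otimes>\<^bsub>cocycle_group p X\<^esub>) = (\<otimes>\<^bsub>cochain_group p X\<^esub>)"
  by (simp add: cocycle_group_def)

lemma cocycle_set_iff:
  "\<phi> \<in> cocycle_set p X \<longleftrightarrow>
     \<phi> \<in> carrier (cochain_group p X) \<and> (\<forall>c. singular_chain (Suc p) X c \<longrightarrow> \<phi> (chain_boundary (Suc p) c) = 0)"
  by (auto simp: cocycle_set_def kernel_def coboundary_def cochain_one fun_eq_iff restrict_def)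

lemma chain_boundary_degree_0: "chain_boundary 0 c = 0"
  by (simp add: chain_boundary_def)

lemma additive_on_singular_chain_0:
  "additive_on (singular_chain_set p X) h \<Longrightarrow> h 0 = 0"
  by (rule additive_on_0) (auto simp: add_subgroup_def singular_chain_diff)

text \<open>In degree 0 truncated subtraction turns p - 1 into 0, but the boundary map is 0 there,
  so the right-hand side describes only the zero cochain.\<close>

lemma coboundary_set_iff:
  "\<phi> \<in> coboundary_set p X \<longleftrightarrow>
     (\<exists>\<psi>\<in>carrier (cochain_group (p - 1) X). \<phi> = (\<lambda>c\<in>singular_chain_set p X. \<psi> (chain_boundary p c)))"
proof (cases p)
  case 0
  have "(\<lambda>c\<in>singular_chain_set 0 X. \<psi> (chain_boundary 0 c)) = \<one>\<^bsub>cochain_group 0 X\<^esub>"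
    if "\<psi> \<in> carrier (cochain_group 0 X)" for \<psi>
    using that additive_on_singular_chain_0[of 0 X \<psi>]
    by (simp add: chain_boundary_degree_0 cochain_carrier_iff cochain_one)
  then show ?thesis
    using 0 monoid.one_closed[OF group.is_monoid[OF group_cochain_group], of 0 X] by (auto simp: coboundary_set_def)
qed (auto simp: coboundary_set_def coboundary_def)

lemma subgroup_coboundary_set: "subgroup (coboundary_set p X) (cochain_group p X)"
proof (cases p)
  case 0
  then show ?thesis
    by (simp add: coboundary_set_def group.triv_subgroup[OF group_cochain_group])
next
  case (Suc q)
  then show ?thesis
    by (simp add: coboundary_set_def group_hom.img_is_subgroup[OF group_hom_coboundary])
qed

lemma carrier_cohomology_group:
  "carrier (cohomology_group p X) = (\<lambda>\<phi>. coboundary_set p X #>\<^bsub>cochain_group p X\<^esub> \<phi>) ` cocycle_set p X"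
  by (auto simp: cohomology_group_def FactGroup_def RCOSETS_def carrier_cocycle_group r_coset_def mult_cocycle_group)

lemma coboundary_in_cocycle_set: "\<phi> \<in> coboundary_set p X \<Longrightarrow> \<phi> \<in> cocycle_set p X"
  unfolding coboundary_set_iff cocycle_set_iff
  using singular_chain_boundary[of p X] singular_chain_boundary_alt[of p X] chain_boundary_boundary_alt[of p X]
  by (auto intro!: restrict_in_cochain_group
      simp: additive_on_def cochain_carrier_iff chain_boundary_add additive_on_singular_chain_0 singular_chain_add)

lemma cocycle_in_own_coset:
  assumes "\<phi> \<in> cocycle_set p X" shows "\<phi> \<in> coboundary_set p X #>\<^bsub>cochain_group p X\<^esub> \<phi>"
  using assms
  by (intro group.rcos_self[OF group_cochain_group _ subgroup_coboundary_set]) (simp add: cocycle_set_iff)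

lemma cohomology_class_subset_cocycle_set:
  "u \<in> carrier (cohomology_group p X) \<Longrightarrow> u \<subseteq> cocycle_set p X"
  unfolding carrier_cohomology_group r_coset_def
  using coboundary_in_cocycle_set subgroup.m_closed[OF subgroup_cocycle_set] by blast

lemma cochain_map_coboundary:
  assumes f: "continuous_map X X f" and b: "b \<in> coboundary_set p X"
  shows "cochain_map p X f b \<in> coboundary_set p X"
proof -
  obtain \<psi> where \<psi>: "\<psi> \<in> carrier (cochain_group (p - 1) X)"
    and b: "b = (\<lambda>c\<in>singular_chain_set p X. \<psi> (chain_boundary p c))"
    using b by (auto simp: coboundary_set_iff)
  have "cochain_map (p - 1) X f \<psi> \<in> carrier (cochain_group (p - 1) X)"
    unfolding cochain_map_def carrier_chain_group
    using \<psi> singular_chain_chain_map[OF _ f]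
    by (intro restrict_in_cochain_group) (simp add: cochain_carrier_iff additive_on_def chain_map_add)
  moreover have "cochain_map p X f b = (\<lambda>c\<in>singular_chain_set p X. cochain_map (p - 1) X f \<psi> (chain_boundary p c))"
    using singular_chain_chain_map[OF _ f] singular_chain_boundary[of p X] chain_boundary_chain_map[of p X _ f]
    by (auto simp: cochain_map_def b fun_eq_iff)
  ultimately show ?thesis unfolding coboundary_set_iff by blast
qed

text \<open>All members of the coset pull back to coboundaries, and the product of a subgroup with a
  nonempty subset of itself is the subgroup.\<close>

lemma cohom_induced_eq_coboundary_set:
  assumes f: "continuous_map X X f"
    and h: "cochain_map p X f h \<in> coboundary_set p X"
  shows "cohom_induced p X f (coboundary_set p X #>\<^bsub>cochain_group p X\<^esub> h) = coboundary_set p X"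
proof -
  let ?G = "cochain_group p X" and ?B = "coboundary_set p X"
  let ?V = "cochain_map p X f ` (?B #>\<^bsub>?G\<^esub> h)"
  interpret G: group ?G by (rule group_cochain_group)
  interpret B: subgroup ?B ?G by (rule subgroup_coboundary_set)
  have V: "v \<in> ?B" if v: "v \<in> ?V" for v
  proof -
    obtain b where b: "b \<in> ?B" "v = cochain_map p X f (b \<otimes>\<^bsub>?G\<^esub> h)"
      using v by (auto simp: r_coset_def)
    then have "v = cochain_map p X f b \<otimes>\<^bsub>?G\<^esub> cochain_map p X f h"
      using singular_chain_chain_map[OF _ f] by (auto simp: cochain_map_def cochain_mult fun_eq_iff)
    then show ?thesis using b h cochain_map_coboundary[OF f] B.m_closed by simp
  qed
  obtain v where v: "v \<in> ?V" using B.one_closed unfolding r_coset_def by blast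
  have "?B <#>\<^bsub>?G\<^esub> ?V = ?B"
  proof
    show "?B <#>\<^bsub>?G\<^esub> ?V \<subseteq> ?B"
      unfolding set_mult_def using V B.m_closed by blast
    show "?B \<subseteq> ?B <#>\<^bsub>?G\<^esub> ?V"
    proof
      fix b assume b: "b \<in> ?B"
      have "b = (b \<otimes>\<^bsub>?G\<^esub> inv\<^bsub>?G\<^esub> v) \<otimes>\<^bsub>?G\<^esub> v"
        using B.mem_carrier[OF b] B.mem_carrier[OF V[OF v]] by (simp add: G.m_assoc)
      then show "b \<in> ?B <#>\<^bsub>?G\<^esub> ?V"
        unfolding set_mult_def using v b V[OF v] B.m_closed B.m_inv_closed by blast
    qed
  qed
  then show ?thesis
    by (simp add: cohom_induced_def set_mult_def mult_cocycle_group)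
qed

section \<open>Singular chains as an instance of the abstract setting\<close>

lemma chain_endomorphism_chain_map:
  assumes f: "continuous_map X X f"
  shows "chain_endomorphism (\<lambda>p. singular_chain_set p X) chain_boundary (\<lambda>p. chain_map p f)"
  using singular_chain_boundary[of _ X] chain_boundary_boundary_alt[of _ X]
    singular_chain_chain_map[OF _ f] chain_boundary_chain_map[of _ X _ f]
  by unfold_locales
    (auto simp: add_subgroup_def additive_on_def singular_chain_diff chain_boundary_add chain_map_add)

context
  fixes X :: "'a topology" and f
  assumes f: "continuous_map X X f"
begin

interpretation chain_endomorphism "\<lambda>p. singular_chain_set p X" chain_boundary "\<lambda>p. chain_map p f"
  by (rule chain_endomorphism_chain_map[OF f])

lemma cycles_eq: "cycles p = singular_relcycle_set p X {}"
  by (auto simp: cycles_def singular_cycle)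

lemma boundaries_eq: "boundaries p = singular_relboundary_set p X {}"
  by (auto simp: boundaries_def singular_boundary)

text \<open>The floor recovers the integer cochain from its rational encoding, and restriction makes
  it extensional.\<close>

lemma int_cochain_iff:
  "int_cochain p \<theta> \<longleftrightarrow>
     (\<exists>\<phi>\<in>carrier (cochain_group p X). \<forall>c. singular_chain p X c \<longrightarrow> \<theta> c = of_int (\<phi> c))"
proof
  assume \<theta>: "int_cochain p \<theta>"
  let ?\<phi> = "\<lambda>c\<in>singular_chain_set p X. \<lfloor>\<theta> c\<rfloor>"
  have fl: "of_int \<lfloor>\<theta> c\<rfloor> = \<theta> c" if "singular_chain p X c" for c
    using \<theta> that by (auto simp: int_cochain_def image_subset_iff)
  have "additive_on (singular_chain_set p X) (\<lambda>c. \<lfloor>\<theta> c\<rfloor>)"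
    unfolding additive_on_def
  proof (intro ballI)
    fix a b assume "a \<in> singular_chain_set p X" "b \<in> singular_chain_set p X"
    then have add: "\<theta> (a + b) = \<theta> a + \<theta> b"
      and ab: "singular_chain p X a" "singular_chain p X b" "singular_chain p X (a + b)"
      using \<theta> by (auto simp: int_cochain_def additive_on_def singular_chain_add)
    have "of_int \<lfloor>\<theta> (a + b)\<rfloor> = (of_int (\<lfloor>\<theta> a\<rfloor> + \<lfloor>\<theta> b\<rfloor>) :: rat)"
      unfolding of_int_add fl[OF ab(1)] fl[OF ab(2)] fl[OF ab(3)] by (rule add)
    then show "\<lfloor>\<theta> (a + b)\<rfloor> = \<lfloor>\<theta> a\<rfloor> + \<lfloor>\<theta> b\<rfloor>" by (simp only: of_int_eq_iff)
  qed
  then show "\<exists>\<phi>\<in>carrier (cochain_group p X). \<forall>c. singular_chain p X c \<longrightarrow> \<theta> c = of_int (\<phi> c)"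
    by (intro bexI[of _ ?\<phi>] restrict_in_cochain_group) (auto simp: fl)
next
  assume "\<exists>\<phi>\<in>carrier (cochain_group p X). \<forall>c. singular_chain p X c \<longrightarrow> \<theta> c = of_int (\<phi> c)"
  then show "int_cochain p \<theta>"
    by (auto simp: int_cochain_def cochain_carrier_iff additive_on_def singular_chain_add image_subset_iff)
qed

lemma int_cocycle_iff:
  "int_cocycle p \<theta> \<longleftrightarrow> (\<exists>\<phi>\<in>cocycle_set p X. \<forall>c. singular_chain p X c \<longrightarrow> \<theta> c = of_int (\<phi> c))"
proof -
  have "(\<forall>c\<in>singular_chain_set (Suc p) X. \<theta> (chain_boundary (Suc p) c) = 0) \<longleftrightarrow>
      (\<forall>c. singular_chain (Suc p) X c \<longrightarrow> \<phi> (chain_boundary (Suc p) c) = 0)"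
    if "\<forall>c. singular_chain p X c \<longrightarrow> \<theta> c = of_int (\<phi> c)" for \<phi>
    using that singular_chain_boundary_alt[of p X] by simp
  note eq = this
  show ?thesis
  proof
    assume \<theta>: "int_cocycle p \<theta>"
    then obtain \<phi> where \<phi>: "\<phi> \<in> carrier (cochain_group p X)" "\<forall>c. singular_chain p X c \<longrightarrow> \<theta> c = of_int (\<phi> c)"
      unfolding int_cocycle_def int_cochain_iff by blast
    have "\<phi> \<in> cocycle_set p X"
      unfolding cocycle_set_iff using \<phi>(1) eq[OF \<phi>(2)] \<theta> int_cocycle_def by metis
    with \<phi>(2) show "\<exists>\<phi>\<in>cocycle_set p X. \<forall>c. singular_chain p X c \<longrightarrow> \<theta> c = of_int (\<phi> c)" ..
  next
    assume "\<exists>\<phi>\<in>cocycle_set p X. \<forall>c. singular_chain p X c \<longrightarrow> \<theta> c = of_int (\<phi> c)"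
    then obtain \<phi> where \<phi>: "\<phi> \<in> cocycle_set p X" "\<forall>c. singular_chain p X c \<longrightarrow> \<theta> c = of_int (\<phi> c)" ..
    have "int_cochain p \<theta>"
      unfolding int_cochain_iff using \<phi> cocycle_set_iff by blast
    then show "int_cocycle p \<theta>"
      unfolding int_cocycle_def eq[OF \<phi>(2)] using \<phi>(1) by (simp add: cocycle_set_iff)
  qed
qed

lemma cohom_surjective_if_iso:
  assumes "cohom_induced p X f \<in> iso (cohomology_group p X) (cohomology_group p X)"
  shows "cohom_surjective p"
  unfolding cohom_surjective_def
proof (intro allI impI)
  fix \<gamma> assume "int_cocycle p \<gamma>"
  then obtain g where g: "g \<in> cocycle_set p X" "\<And>c. singular_chain p X c \<Longrightarrow> \<gamma> c = of_int (g c)"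
    unfolding int_cocycle_iff by blast
  have "coboundary_set p X #>\<^bsub>cochain_group p X\<^esub> g \<in> cohom_induced p X f ` carrier (cohomology_group p X)"
    using assms g(1) by (simp add: iso_def bij_betw_def carrier_cohomology_group)
  then obtain u where u: "u \<in> carrier (cohomology_group p X)"
    and "cohom_induced p X f u = coboundary_set p X #>\<^bsub>cochain_group p X\<^esub> g"
    by (metis imageE)
  \<comment> \<open>A coset contains its representative, so equality of cosets gives an equation
    between cochains.\<close>
  then have "g \<in> coboundary_set p X <#>\<^bsub>cochain_group p X\<^esub> cochain_map p X f ` u"
    using cocycle_in_own_coset[OF g(1)] by (simp add: cohom_induced_def set_mult_def mult_cocycle_group)
  then obtain b g' where b: "b \<in> coboundary_set p X" and g': "g' \<in> u"
    and eq: "g = b \<otimes>\<^bsub>cochain_group p X\<^esub> cochain_map p X f g'"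
    by (auto simp: set_mult_def)
  have g'': "g' \<in> cocycle_set p X" using u g' cohomology_class_subset_cocycle_set by blast
  obtain \<psi> where \<psi>: "\<psi> \<in> carrier (cochain_group (p - 1) X)"
    and b': "b = (\<lambda>c\<in>singular_chain_set p X. \<psi> (chain_boundary p c))"
    using b by (auto simp: coboundary_set_iff)
  have "int_cocycle p (\<lambda>c. of_int (g' c))" unfolding int_cocycle_iff using g'' by blast
  moreover have "int_cochain (p - 1) (\<lambda>c. of_int (\<psi> c))" unfolding int_cochain_iff using \<psi> by blast
  moreover have "\<gamma> c = of_int (g' (chain_map p f c)) + of_int (\<psi> (chain_boundary p c))"
    if "singular_chain p X c" for c
    using that g(2)[OF that] by (simp add: eq cochain_mult b' cochain_map_def)
  ultimately show "\<exists>\<gamma>' \<psi>. int_cocycle p \<gamma>' \<and> int_cochain (p - 1) \<psi> \<and>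
      (\<forall>c\<in>singular_chain_set p X. \<gamma> c = \<gamma>' (chain_map p f c) + \<psi> (chain_boundary p c))"
    by blast
qed

lemma cohom_injective_if_iso:
  assumes iso: "cohom_induced p X f \<in> iso (cohomology_group p X) (cohomology_group p X)"
  shows "cohom_injective p"
  unfolding cohom_injective_def
proof (intro allI impI)
  let ?G = "cochain_group p X" and ?B = "coboundary_set p X"
  interpret G: group ?G by (rule group_cochain_group)
  interpret B: subgroup ?B ?G by (rule subgroup_coboundary_set)
  fix \<beta> \<psi>
  assume "int_cocycle p \<beta>" "int_cochain (p - 1) \<psi>"
    and \<beta>\<psi>: "\<forall>c\<in>singular_chain_set p X. \<beta> (chain_map p f c) = \<psi> (chain_boundary p c)"
  then obtain g h where g: "g \<in> cocycle_set p X" "\<And>c. singular_chain p X c \<Longrightarrow> \<beta> c = of_int (g c)"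
    and h: "h \<in> carrier (cochain_group (p - 1) X)" "\<And>c. singular_chain (p - 1) X c \<Longrightarrow> \<psi> c = of_int (h c)"
    unfolding int_cocycle_iff int_cochain_iff by metis
  have "g (chain_map p f c) = h (chain_boundary p c)" if c: "singular_chain p X c" for c
  proof -
    have "of_int (g (chain_map p f c)) = (of_int (h (chain_boundary p c)) :: rat)"
      using \<beta>\<psi> c g(2)[OF singular_chain_chain_map[OF c f]] h(2)[of "chain_boundary p c"] singular_chain_boundary[OF c]
      by simp
    then show ?thesis by simp
  qed
  then have "cochain_map p X f g = (\<lambda>c\<in>singular_chain_set p X. h (chain_boundary p c))"
    by (auto simp: cochain_map_def fun_eq_iff)
  then have "cochain_map p X f g \<in> ?B" using h(1) unfolding coboundary_set_iff by blast
  then have "cohom_induced p X f (?B #>\<^bsub>?G\<^esub> g) = ?B"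
    by (rule cohom_induced_eq_coboundary_set[OF f])
  \<comment> \<open>The trivial class has the same image as the class of \<open>g\<close>, so
    injectivity can be applied to the two cosets.\<close>
  moreover have "cohom_induced p X f (?B #>\<^bsub>?G\<^esub> \<one>\<^bsub>?G\<^esub>) = ?B"
    by (intro cohom_induced_eq_coboundary_set[OF f] cochain_map_coboundary[OF f] B.one_closed)
  moreover have "inj_on (cohom_induced p X f) (carrier (cohomology_group p X))"
    using iso by (simp add: iso_def bij_betw_def)
  moreover have "?B #>\<^bsub>?G\<^esub> g \<in> carrier (cohomology_group p X)" "?B #>\<^bsub>?G\<^esub> \<one>\<^bsub>?G\<^esub> \<in> carrier (cohomology_group p X)"
    using g(1) coboundary_in_cocycle_set[OF B.one_closed] by (auto simp: carrier_cohomology_group)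
  ultimately have "?B #>\<^bsub>?G\<^esub> g = ?B #>\<^bsub>?G\<^esub> \<one>\<^bsub>?G\<^esub>" by (metis inj_onD)
  also have "\<dots> = ?B" using B.subset by (rule G.coset_mult_one)
  finally have "g \<in> ?B" using cocycle_in_own_coset[OF g(1)] by simp
  then obtain h' where h': "h' \<in> carrier (cochain_group (p - 1) X)"
    "g = (\<lambda>c\<in>singular_chain_set p X. h' (chain_boundary p c))"
    by (auto simp: coboundary_set_iff)
  have "int_cochain (p - 1) (\<lambda>c. of_int (h' c))" unfolding int_cochain_iff using h'(1) by blast
  moreover have "\<beta> c = of_int (h' (chain_boundary p c))" if "singular_chain p X c" for c
    using g(2)[OF that] that by (simp add: h'(2))
  ultimately show "\<exists>\<psi>'. int_cochain (p - 1) \<psi>' \<and> (\<forall>c\<in>singular_chain_set p X. \<beta> c = \<psi>' (chain_boundary p c))"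
    by blast
qed

text \<open>\<open>S\<close> consists of representatives of the generators. A subgroup containing
  the boundaries contains a whole homology class as soon as it contains one member, so induction
  over \<open>generate\<close> applies to classes as subsets of \<open>A\<close>.\<close>

lemma homology_generated_by_if_finitely_generated:
  assumes "finitely_generated_group (homology_group (int p) X)"
  obtains S where "homology_generated_by p S"
proof -
  let ?H = "homology_group (int p) X"
  obtain T where T: "finite T" "T \<subseteq> carrier ?H" "generate ?H T = carrier ?H"
    using assms by (auto simp: finitely_generated_group_def)
  have "T \<subseteq> homologous_rel_set p X {} ` cycles p"
    using T(2) unfolding carrier_relative_homology_group cycles_eq .
  from finite_subset_image[OF T(1) this]
  obtain S where S: "S \<subseteq> cycles p" "finite S" "T = homologous_rel_set p X {} ` S"
    by blast
  have "cycles p \<subseteq> A" if A: "add_subgroup A" and SA: "S \<subseteq> A" and BA: "boundaries p \<subseteq> A" for A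
  proof
    have coset: "x - y \<in> A \<Longrightarrow> x \<in> A \<Longrightarrow> y \<in> A" for x y
      using add_subgroup_diff[OF A, of x "x - y"] by simp
    have TA: "t \<subseteq> A" if "t \<in> T" for t
      using that S(3) SA BA coset by (auto simp: homologous_rel_def boundaries_eq)
    have *: "u \<subseteq> A" if "u \<in> generate ?H T" for u
      using that
    proof (induction rule: generate.induct)
      case one
      then show ?case using BA by (simp add: boundaries_eq)
    next
      case (incl t)
      then show ?case by (rule TA)
    next
      case (inv t)
      then show ?case
        unfolding inv_relative_homology_group[OF subsetD[OF T(2) inv]]
        using TA[OF inv] add_subgroup_minus[OF A] by blast
    next
      case (eng u v)
      then show ?case
        using add_subgroup_add[OF A] by (auto simp: mult_relative_homology_group)
    qed
    fix z assume "z \<in> cycles p"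
    then have "homologous_rel_set p X {} z \<in> generate ?H T"
      unfolding T(3) by (simp add: carrier_relative_homology_group cycles_eq)
    from *[OF this] show "z \<in> A" by auto
  qed
  then show thesis using S by (intro that[of S]) (auto simp: homology_generated_by_def)
qed

text \<open>From degree p + 1, surjectivity on homology takes the injectivity on cohomology, and
  injectivity takes the surjectivity.\<close>

theorem homology_iso_if_cohomology_iso:
  assumes fg: "finitely_generated_group (homology_group (int p) X)"
      "finitely_generated_group (homology_group (int (Suc p)) X)"
    and iso: "cohom_induced p X f \<in> iso (cohomology_group p X) (cohomology_group p X)"
      "cohom_induced (Suc p) X f \<in> iso (cohomology_group (Suc p) X) (cohomology_group (Suc p) X)"
  shows "hom_induced (int p) X {} X {} f \<in> iso (homology_group (int p) X) (homology_group (int p) X)"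
proof -
  let ?H = "homology_group (int p) X" and ?F = "hom_induced (int p) X {} X {} f"
  let ?cl = "homologous_rel_set p X {}"
  obtain S T where S: "homology_generated_by p S" and T: "homology_generated_by (Suc p) T"
    using homology_generated_by_if_finitely_generated fg by metis
  note surj = cohom_surjective_if_iso[OF iso(1)] and surj' = cohom_surjective_if_iso[OF iso(2)]
  have F: "?F (?cl z) = ?cl (chain_map p f z)" if "z \<in> cycles p" for z
    using that f by (intro hom_induced_chain_map) (auto simp: cycles_eq)
  have H: "carrier ?H = ?cl ` cycles p"
    by (simp add: carrier_relative_homology_group cycles_eq)
  have "inj_on ?F (carrier ?H)"
  proof (rule inj_onI)
    fix u v assume uv: "u \<in> carrier ?H" "v \<in> carrier ?H" "?F u = ?F v"
    then obtain y z where yz: "y \<in> cycles p" "z \<in> cycles p" "u = ?cl y" "v = ?cl z" by (auto simp: H)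
    with uv(3) F have "?cl (chain_map p f y) = ?cl (chain_map p f z)" by simp
    then have "chain_map p f (y - z) \<in> boundaries p"
      unfolding homologous_rel_set_eq by (simp add: homologous_rel_def boundaries_eq chain_map_diff)
    then have "y - z \<in> boundaries p"
      by (rule homology_injective[OF S surj T surj' add_subgroup_diff[OF cycles yz(1,2)]])
    then show "u = v" unfolding yz homologous_rel_set_eq by (simp add: homologous_rel_def boundaries_eq)
  qed
  moreover have "?F ` carrier ?H = carrier ?H"
  proof
    show "?F ` carrier ?H \<subseteq> carrier ?H" by (auto simp: hom_induced_carrier)
    show "carrier ?H \<subseteq> ?F ` carrier ?H"
    proof
      fix u assume "u \<in> carrier ?H"
      then obtain z where z: "z \<in> cycles p" "u = ?cl z" by (auto simp: H)
      then obtain z' where z': "z' \<in> cycles p" "z - chain_map p f z' \<in> boundaries p"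
        using homology_surjective[OF S surj cohom_injective_if_iso[OF iso(2)]] by blast
      then have "u = ?F (?cl z')"
        unfolding F[OF z'(1)] z(2) homologous_rel_set_eq by (simp add: homologous_rel_def boundaries_eq)
      then show "u \<in> ?F ` carrier ?H" using z' by (auto simp: H)
    qed
  qed
  ultimately show ?thesis
    by (simp add: iso_def bij_betw_def hom_induced_hom)
qed

end

section \<open>Comparison of the two self-closeness numbers\<close>

lemma continuous_map_if_in_self_map_class:
  "K \<in> self_map_classes X x0 \<Longrightarrow> f \<in> K \<Longrightarrow> continuous_map X X f"
  by (auto simp: self_map_classes_def based_homotopic_def quotient_def dest: homotopic_with_imp_continuous_maps)

theorem proposition43:
  fixes X :: "'a topology" and x0 :: 'a
  assumes "x0 \<in> topspace X"
    and "\<And>q::nat. finitely_generated_group (homology_group (int q) X)"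
    and "homology_self_closeness_defined X x0"
    and "cohomology_self_closeness_defined X x0"
  shows "cohomology_self_closeness X x0 \<le> homology_self_closeness X x0 + 1"
proof (rule ccontr)
  let ?n = "homology_self_closeness X x0" and ?m = "cohomology_self_closeness X x0"
  assume "\<not> ?thesis"
  then have less: "?n + 1 < ?m" by simp
  have n: "homology_iso_classes ?n X x0 = self_equivalence_classes X x0"
    using assms(3) unfolding homology_self_closeness_defined_def homology_self_closeness_def by (rule LeastI_ex)
  have m: "cohomology_iso_classes ?m X x0 = self_equivalence_classes X x0"
    using assms(4) unfolding cohomology_self_closeness_defined_def cohomology_self_closeness_def by (rule LeastI_ex)
  have "cohomology_iso_classes (?n + 1) X x0 \<subseteq> homology_iso_classes ?n X x0"
  proof
    fix K assume "K \<in> cohomology_iso_classes (?n + 1) X x0"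
    then obtain f where K: "K \<in> self_map_classes X x0" and f: "f \<in> K"
      and iso: "\<And>i. enat i \<le> ?n + 1 \<Longrightarrow> cohom_induced i X f \<in> iso (cohomology_group i X) (cohomology_group i X)"
      by (auto simp: cohomology_iso_classes_def)
    have "hom_induced (int i) X {} X {} f \<in> iso (homology_group (int i) X) (homology_group (int i) X)"
      if "enat i \<le> ?n" for i
    proof (rule homology_iso_if_cohomology_iso[OF continuous_map_if_in_self_map_class[OF K f] assms(2) assms(2)])
      \<comment> \<open>The shift by one: homology in degree \<open>i\<close> uses cohomology in
        degrees \<open>i\<close> and i + 1. The case distinction covers an infinite
        \<open>?n\<close>.\<close>
      have "enat (Suc i) \<le> ?n + 1" using that by (cases ?n) (auto simp: one_enat_def)
      moreover from this have "enat i \<le> ?n + 1" by (rule order_trans[rotated]) simp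
      ultimately show "cohom_induced i X f \<in> iso (cohomology_group i X) (cohomology_group i X)"
        "cohom_induced (Suc i) X f \<in> iso (cohomology_group (Suc i) X) (cohomology_group (Suc i) X)"
        by (simp_all add: iso)
    qed
    then show "K \<in> homology_iso_classes ?n X x0"
      using K f by (auto simp: homology_iso_classes_def)
  qed
  \<comment> \<open>The sets shrink as the bound grows. That self-equivalences induce isomorphisms
    up to degree \<open>?n + 1\<close> is thus read off from \<open>m\<close>, and the chain of
    inclusions closes up.\<close>
  moreover have "cohomology_iso_classes ?m X x0 \<subseteq> cohomology_iso_classes (?n + 1) X x0"
    using less by (force simp: cohomology_iso_classes_def)
  ultimately have "cohomology_iso_classes (?n + 1) X x0 = self_equivalence_classes X x0"
    using n m by blast
  then have "?m \<le> ?n + 1"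
    unfolding cohomology_self_closeness_def by (rule Least_le)
  with less show False by simp
qed

end
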